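(* Let $p \colon E \to B$ be a fibration and let $R$ be a commutative ring. If there exist cohomology classes $u_1,\dots,u_k \in H^*(SP^2_B(E);R)$ such that \begin{enumerate} \item $u_i$ restricts to zero in $H^*(dE_B;R)$ for $i=1,\dots,k$; \item $u_1 \smile \dots \smile u_k \neq 0$ in $H^*(SP^2_B(E);R)$, \end{enumerate} then $\mathrm{TC}^{\Sigma}[p \colon E \to B]\geq k$.
   Context: Fibration means Hurewicz fibration, $I=[0,1]$, $G = \mathbb{Z}_2 = \langle g\rangle$. For a fibration $p \colon E \to B$: $E \times_B E = \{(e_1,e_2)\in E\times E \mid p(e_1)=p(e_2)\}$ with $g\cdot(e_1,e_2)=(e_2,e_1)$ and diagonal $\Delta E = \{(e,e)\mid e \in E\}$; $E^I_B = \{\gamma \in E^I \mid p\circ\gamma \text{ is constant}\}$ (subspace of $E^I$ with compact-open topology) with $(g\cdot\gamma)(t)=\gamma(1-t)$; $\Pi \colon E^I_B \to E \times_B E$, $\Pi(\gamma)=(\gamma(0),\gamma(1))$, is a $G$-fibration. The fibrewise symmetric square is the orbit space $SP^2_B(E) := (E\times_B E)/G$, with orbit map $\rho \colon E\times_B E \to SP^2_B(E)$, and $dE_B := \rho(\Delta E)$. The equivariant sectional category $\mathrm{secat}_G(q)$ of a $G$-map $q \colon X \to Y$ is the least nonnegative integer $n$ such that $Y$ has a cover by $G$-invariant open sets $U_0,\dots,U_n$ with $G$-maps $s_i \colon U_i \to X$ such that $q\circ s_i$ is $G$-homotopic to the inclusion $U_i \hookrightarrow Y$ ($\infty$ if none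 exists). The symmetrized parametrized topological complexity is $\mathrm{TC}^{\Sigma}[p \colon E\to B] := \mathrm{secat}_G(\Pi)$. *)

theory Defs
  imports "HOL-Analysis.Analysis" "HOL-Homology.Homology" "HOL-Algebra.QuotRing" "HOL-Library.Extended_Nat"
begin

section \<open>Function spaces and Hurewicz fibrations\<close>

abbreviation unit_interval :: "real topology"
  where "unit_interval \<equiv> top_of_set {0..1}"

text \<open>Points of the function space are functions that take the value \<^term>\<open>undefined\<close>
  outside the domain, so that each continuous map is represented exactly once.\<close>

definition cmaps :: "'a topology \<Rightarrow> 'b topology \<Rightarrow> ('a \<Rightarrow> 'b) set"
  where "cmaps X Y = {f \<in> extensional (topspace X). continuous_map X Y f}"

definition compact_open_topology :: "'a topology \<Rightarrow> 'b topology \<Rightarrow> ('a \<Rightarrow> 'b) topology"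
  where "compact_open_topology X Y =
    topology_generated_by {{f \<in> cmaps X Y. f ` K \<subseteq> U} | K U. compactin X K \<and> openin Y U}"

definition homotopy_lifting ::
    "'z topology \<Rightarrow> 'e topology \<Rightarrow> 'b topology \<Rightarrow> ('e \<Rightarrow> 'b) \<Rightarrow> bool"
  where "homotopy_lifting Z E B p \<longleftrightarrow>
    (\<forall>f H. continuous_map Z E f \<longrightarrow>
       continuous_map (prod_topology Z unit_interval) B H \<longrightarrow>
       (\<forall>z\<in>topspace Z. H (z, 0) = p (f z)) \<longrightarrow>
       (\<exists>K. continuous_map (prod_topology Z unit_interval) E K \<and>
            (\<forall>z\<in>topspace Z. K (z, 0) = f z) \<and>
            (\<forall>z\<in>topspace Z. \<forall>t\<in>{0..1}. p (K (z, t)) = H (z, t))))"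

text \<open>A Hurewicz fibration has the homotopy lifting property for all spaces. HOL cannot
  quantify over types inside a definition, so \<open>Z\<close> ranges over all spaces whose points lie in
  one fixed type. That type is large enough to carry the mapping path space of \<open>p\<close>, and
  theorem \<open>hurewicz_fibration_imp_homotopy_lifting\<close> below shows that nothing is lost: the lifting property then
  holds for spaces over every type.\<close>

definition hurewicz_fibration :: "'e topology \<Rightarrow> 'b topology \<Rightarrow> ('e \<Rightarrow> 'b) \<Rightarrow> bool"
  where "hurewicz_fibration E B p \<longleftrightarrow>
    continuous_map E B p \<and>
    (\<forall>Z :: ('e \<times> (real \<Rightarrow> 'b)) topology. homotopy_lifting Z E B p)"

lemma topspace_compact_open_topology [simp]:
  "topspace (compact_open_topology X Y) = cmaps X Y"
proof -
  have "cmaps X Y \<in> {{f \<in> cmaps X Y. f ` K \<subseteq> U} | K U. compactin X K \<and> openin Y U}"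
    by (rule CollectI, rule exI[of _ "{}"], rule exI[of _ "{}"]) auto
  then show ?thesis
    unfolding compact_open_topology_def topology_generated_by_topspace by blast
qed

lemma openin_compact_open_subbasic:
  "compactin X K \<Longrightarrow> openin Y U \<Longrightarrow>
    openin (compact_open_topology X Y) {f \<in> cmaps X Y. f ` K \<subseteq> U}"
  unfolding compact_open_topology_def by (rule topology_generated_by_Basis) blast

lemma continuous_map_curry:
  assumes H: "continuous_map (prod_topology Z X) Y H"
  shows "continuous_map Z (compact_open_topology X Y) (\<lambda>z. restrict (\<lambda>x. H (z, x)) (topspace X))"
proof -
  let ?c = "\<lambda>z. restrict (\<lambda>x. H (z, x)) (topspace X)"
  have c: "?c z \<in> cmaps X Y" if "z \<in> topspace Z" for z
  proof -
    have "continuous_map X (prod_topology Z X) (\<lambda>x. (z, x))"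
      using that by (intro continuous_intros) auto
    then have "continuous_map X Y (\<lambda>x. H (z, x))"
      using continuous_map_compose[OF _ H] by (simp add: o_def)
    then have "continuous_map X Y (?c z)"
      by (rule continuous_map_eq) auto
    then show ?thesis
      by (simp add: cmaps_def)
  qed
  have "openin Z {z \<in> topspace Z. ?c z \<in> V}"
    if V: "V = {f \<in> cmaps X Y. f ` K \<subseteq> U}" and K: "compactin X K" and U: "openin Y U" for V K U
  proof (subst openin_subopen, intro ballI)
    fix z assume "z \<in> {z \<in> topspace Z. ?c z \<in> V}"
    then have z: "z \<in> topspace Z" and zK: "?c z ` K \<subseteq> U"
      using V by auto
    have KX: "K \<subseteq> topspace X"
      using K compactin_subset_topspace by blast
    let ?W = "{w \<in> topspace (prod_topology Z X). H w \<in> U}"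
    have W: "openin (prod_topology Z X) ?W"
      using H U by (rule openin_continuous_map_preimage)
    have "{z} \<times> K \<subseteq> ?W"
      using z zK KX by force
    then obtain S T where S: "openin Z S" "z \<in> S" "K \<subseteq> T" "S \<times> T \<subseteq> ?W"
      using tube_lemma_right[OF W K z] by blast
    have "S \<subseteq> {z \<in> topspace Z. ?c z \<in> V}"
    proof
      fix s assume s: "s \<in> S"
      then have sZ: "s \<in> topspace Z"
        using S openin_subset by blast
      have "?c s ` K \<subseteq> U"
        using s S KX by force
      then show "s \<in> {z \<in> topspace Z. ?c z \<in> V}"
        using sZ c V by auto
    qed
    then show "\<exists>T. openin Z T \<and> z \<in> T \<and> T \<subseteq> {z \<in> topspace Z. ?c z \<in> V}"
      using S by blast
  qed
  then have ope: "openin Z (?c -` V \<inter> topspace Z)"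
    if "V \<in> {{f \<in> cmaps X Y. f ` K \<subseteq> U} | K U. compactin X K \<and> openin Y U}" for V
    using that by (force simp: vimage_def Int_def conj_commute)
  have "?c ` topspace Z \<subseteq> topspace (compact_open_topology X Y)"
    using c by auto
  then show ?thesis
    unfolding compact_open_topology_def
    by (intro continuous_on_generated_topo ope) auto
qed

lemma continuous_map_path_eval:
  "continuous_map (prod_topology (compact_open_topology unit_interval Y) unit_interval) Y
    (\<lambda>(\<gamma>, t). \<gamma> t)"
proof -
  let ?P = "compact_open_topology unit_interval Y"
  have "openin (prod_topology ?P unit_interval)
          {w \<in> topspace (prod_topology ?P unit_interval). (\<lambda>(\<gamma>, t). \<gamma> t) w \<in> U}"
    if U: "openin Y U" for U
  proof (subst openin_subopen, intro ballI)
    fix w assume "w \<in> {w \<in> topspace (prod_topology ?P unit_interval). (\<lambda>(\<gamma>, t). \<gamma> t) w \<in> U}"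
    then obtain \<gamma> t where w: "w = (\<gamma>, t)" "\<gamma> \<in> cmaps unit_interval Y" "t \<in> {0..1}" "\<gamma> t \<in> U"
      by auto
    have "openin unit_interval {x \<in> topspace unit_interval. \<gamma> x \<in> U}"
      using w U by (intro openin_continuous_map_preimage[of _ Y]) (auto simp: cmaps_def)
    then obtain T where T: "open T" "{x \<in> topspace unit_interval. \<gamma> x \<in> U} = {0..1} \<inter> T"
      by (auto simp: openin_open)
    then have "t \<in> T" using w by auto
    then obtain e where e: "e > 0" "cball t e \<subseteq> T"
      using T open_contains_cball by blast
    let ?K = "{0..1} \<inter> cball t e"
    have "compact ?K" by (intro compact_Int) auto
    then have K: "compactin unit_interval ?K"
      by (simp add: compactin_subtopology)
    let ?A = "{f \<in> cmaps unit_interval Y. f ` ?K \<subseteq> U}"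
    let ?J = "{0..1} \<inter> ball t e"
    have "openin (prod_topology ?P unit_interval) (?A \<times> ?J)"
      using openin_compact_open_subbasic[OF K U]
      by (simp add: openin_prod_Times_iff openin_open_Int)
    moreover have "w \<in> ?A \<times> ?J"
    proof -
      have "\<gamma> ` ?K \<subseteq> U" using e T by auto
      then show ?thesis using w e by auto
    qed
    moreover have "?A \<times> ?J \<subseteq> {w \<in> topspace (prod_topology ?P unit_interval). (\<lambda>(\<gamma>, t). \<gamma> t) w \<in> U}"
      by force
    ultimately show "\<exists>T. openin (prod_topology ?P unit_interval) T \<and> w \<in> T \<and>
        T \<subseteq> {w \<in> topspace (prod_topology ?P unit_interval). (\<lambda>(\<gamma>, t). \<gamma> t) w \<in> U}"
      by (intro exI[of _ "?A \<times> ?J"]) simp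
  qed
  moreover have "(\<lambda>(\<gamma>, t). \<gamma> t) \<in> topspace (prod_topology ?P unit_interval) \<rightarrow> topspace Y"
    by (auto simp: cmaps_def continuous_map_def)
  ultimately show ?thesis
    by (simp add: continuous_map_def)
qed

theorem hurewicz_fibration_imp_homotopy_lifting:
  fixes Z :: "'z topology" and E :: "'e topology" and B :: "'b topology"
  assumes fib: "hurewicz_fibration E B p"
  shows "homotopy_lifting Z E B p"
  unfolding homotopy_lifting_def
proof (intro allI impI)
  fix f H
  assume f: "continuous_map Z E f"
    and H: "continuous_map (prod_topology Z unit_interval) B H"
    and H0: "\<forall>z\<in>topspace Z. H (z, 0) = p (f z)"
  let ?P = "compact_open_topology unit_interval B"
  let ?N = "subtopology (prod_topology E ?P) {(e, \<gamma>). \<gamma> 0 = p e}"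
  have "continuous_map ?N E fst"
    using continuous_map_from_subtopology continuous_map_fst by blast
  moreover
  have "continuous_map (prod_topology ?N unit_interval) (prod_topology ?P unit_interval)
          (\<lambda>(x, t). (snd x, t))"
  proof -
    have "continuous_map ?N ?P snd"
      using continuous_map_from_subtopology continuous_map_snd by blast
    then show ?thesis
      by (simp add: continuous_map_prod_top)
  qed
  from continuous_map_compose[OF this continuous_map_path_eval]
  have "continuous_map (prod_topology ?N unit_interval) B (\<lambda>(x, t). snd x t)"
    by (simp add: o_def case_prod_unfold)
  moreover have "homotopy_lifting ?N E B p"
    using fib by (simp add: hurewicz_fibration_def)
  ultimately obtain K where K: "continuous_map (prod_topology ?N unit_interval) E K"
    and K0: "\<And>x. x \<in> topspace ?N \<Longrightarrow> K (x, 0) = fst x"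
    and pK: "\<And>x t. x \<in> topspace ?N \<Longrightarrow> t \<in> {0..1} \<Longrightarrow> p (K (x, t)) = snd x t"
    unfolding homotopy_lifting_def
    by (elim allE[where x = fst] allE[where x = "\<lambda>(x, t). snd x t"]) (auto 4 4)
  define c where "c z = (f z, restrict (\<lambda>t. H (z, t)) {0..1})" for z
  have "continuous_map Z ?P (\<lambda>z. restrict (\<lambda>t. H (z, t)) {0..1})"
    using continuous_map_curry[OF H] by simp
  then have c: "continuous_map Z ?N c"
    using f H0 by (auto simp: c_def[abs_def] continuous_map_in_subtopology continuous_map_paired)
  then have cN: "c z \<in> topspace ?N" if "z \<in> topspace Z" for z
    using that continuous_map_image_subset_topspace[OF c] by blast
  define L where "L = (\<lambda>(z, t). K (c z, t))"
  have "continuous_map (prod_topology Z unit_interval) (prod_topology ?N unit_interval)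
          (\<lambda>(z, t). (c z, t))"
    using c by (simp add: continuous_map_prod_top)
  from continuous_map_compose[OF this K]
  have "continuous_map (prod_topology Z unit_interval) E L"
    by (simp add: L_def o_def case_prod_unfold)
  moreover have "\<forall>z\<in>topspace Z. L (z, 0) = f z"
    using K0[OF cN] by (auto simp: L_def c_def)
  moreover have "\<forall>z\<in>topspace Z. \<forall>t\<in>{0..1}. p (L (z, t)) = H (z, t)"
    using pK[OF cN] by (auto simp: L_def c_def)
  ultimately show "\<exists>K. continuous_map (prod_topology Z unit_interval) E K \<and>
            (\<forall>z\<in>topspace Z. K (z, 0) = f z) \<and>
            (\<forall>z\<in>topspace Z. \<forall>t\<in>{0..1}. p (K (z, t)) = H (z, t))"
    by blast
qed

section \<open>Spaces with an action of the group of order two\<close>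

text \<open>An action of \<open>\<int>\<^sub>2\<close> is given by the involution \<open>x \<mapsto> g \<cdot> x\<close>, which is passed
  around explicitly.\<close>

definition Z2_map :: "'x topology \<Rightarrow> ('x \<Rightarrow> 'x) \<Rightarrow> 'y topology \<Rightarrow> ('y \<Rightarrow> 'y) \<Rightarrow> ('x \<Rightarrow> 'y) \<Rightarrow> bool"
  where "Z2_map X gX Y gY f \<longleftrightarrow>
    continuous_map X Y f \<and> (\<forall>x\<in>topspace X. f (gX x) = gY (f x))"

text \<open>As the action on \<open>[0,1]\<close> is trivial, an equivariant homotopy is one all of whose
  stages are equivariant.\<close>

definition secat_Z2 ::
    "'x topology \<Rightarrow> ('x \<Rightarrow> 'x) \<Rightarrow> 'y topology \<Rightarrow> ('y \<Rightarrow> 'y) \<Rightarrow> ('x \<Rightarrow> 'y) \<Rightarrow> enat"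
  where "secat_Z2 X gX Y gY q =
    Inf {enat n | n. \<exists>U :: nat \<Rightarrow> 'y set.
      (\<Union>i\<le>n. U i) = topspace Y \<and>
      (\<forall>i\<le>n. openin Y (U i) \<and> gY ` U i = U i \<and>
        (\<exists>s. Z2_map (subtopology Y (U i)) gY X gX s \<and>
             homotopic_with (Z2_map (subtopology Y (U i)) gY Y gY)
               (subtopology Y (U i)) Y (q \<circ> s) id))}"

definition quotient_topology :: "'x topology \<Rightarrow> ('x \<Rightarrow> 'y) \<Rightarrow> 'y topology"
  where "quotient_topology X f =
    topology (\<lambda>U. U \<subseteq> f ` topspace X \<and> openin X {x \<in> topspace X. f x \<in> U})"

lemma openin_quotient_topology:
  "openin (quotient_topology X f) U \<longleftrightarrow>
    U \<subseteq> f ` topspace X \<and> openin X {x \<in> topspace X. f x \<in> U}"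
proof -
  have "istopology (\<lambda>U. U \<subseteq> f ` topspace X \<and> openin X {x \<in> topspace X. f x \<in> U})"
    unfolding istopology_def
  proof (rule conjI; intro allI impI)
    fix S T
    assume "S \<subseteq> f ` topspace X \<and> openin X {x \<in> topspace X. f x \<in> S}"
      and "T \<subseteq> f ` topspace X \<and> openin X {x \<in> topspace X. f x \<in> T}"
    moreover have "{x \<in> topspace X. f x \<in> S \<inter> T} =
        {x \<in> topspace X. f x \<in> S} \<inter> {x \<in> topspace X. f x \<in> T}"
      by auto
    ultimately show "S \<inter> T \<subseteq> f ` topspace X \<and> openin X {x \<in> topspace X. f x \<in> S \<inter> T}"
      by auto
  next
    fix \<U>
    assume "\<forall>S\<in>\<U>. S \<subseteq> f ` topspace X \<and> openin X {x \<in> topspace X. f x \<in> S}"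
    moreover have "{x \<in> topspace X. f x \<in> \<Union>\<U>} = (\<Union>S\<in>\<U>. {x \<in> topspace X. f x \<in> S})"
      by auto
    ultimately show "\<Union>\<U> \<subseteq> f ` topspace X \<and> openin X {x \<in> topspace X. f x \<in> \<Union>\<U>}"
      by auto
  qed
  then show ?thesis
    by (simp add: quotient_topology_def)
qed

lemma topspace_quotient_topology [simp]: "topspace (quotient_topology X f) = f ` topspace X"
proof -
  have "{x \<in> topspace X. f x \<in> f ` topspace X} = topspace X"
    by auto
  then have "openin (quotient_topology X f) (f ` topspace X)"
    by (simp add: openin_quotient_topology)
  then show ?thesis
    by (meson openin_quotient_topology openin_subset openin_topspace subset_antisym)
qed

lemma quotient_map_quotient_topology: "quotient_map X (quotient_topology X f) f"
  by (auto simp: quotient_map_def openin_quotient_topology)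

definition Z2_orbit :: "('x \<Rightarrow> 'x) \<Rightarrow> 'x \<Rightarrow> 'x set"
  where "Z2_orbit g x = {x, g x}"

definition Z2_orbit_space :: "'x topology \<Rightarrow> ('x \<Rightarrow> 'x) \<Rightarrow> 'x set topology"
  where "Z2_orbit_space X g = quotient_topology X (Z2_orbit g)"

section \<open>Symmetrized parametrized topological complexity\<close>

definition fibre_product :: "'e topology \<Rightarrow> ('e \<Rightarrow> 'b) \<Rightarrow> ('e \<times> 'e) topology"
  where "fibre_product E p = subtopology (prod_topology E E) {(e1, e2). p e1 = p e2}"

definition fibrewise_paths :: "'e topology \<Rightarrow> ('e \<Rightarrow> 'b) \<Rightarrow> (real \<Rightarrow> 'e) topology"
  where "fibrewise_paths E p =
    subtopology (compact_open_topology unit_interval E) {\<gamma>. \<exists>b. \<forall>t\<in>{0..1}. p (\<gamma> t) = b}"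

definition reverse_path :: "(real \<Rightarrow> 'e) \<Rightarrow> real \<Rightarrow> 'e"
  where "reverse_path \<gamma> = restrict (\<lambda>t. \<gamma> (1 - t)) {0..1}"

definition endpoints :: "(real \<Rightarrow> 'e) \<Rightarrow> 'e \<times> 'e"
  where "endpoints \<gamma> = (\<gamma> 0, \<gamma> 1)"

definition TC_Sigma :: "'e topology \<Rightarrow> ('e \<Rightarrow> 'b) \<Rightarrow> enat"
  where "TC_Sigma E p =
    secat_Z2 (fibrewise_paths E p) reverse_path (fibre_product E p) prod.swap endpoints"

definition SP2 :: "'e topology \<Rightarrow> ('e \<Rightarrow> 'b) \<Rightarrow> ('e \<times> 'e) set topology"
  where "SP2 E p = Z2_orbit_space (fibre_product E p) prod.swap"

definition dE :: "'e topology \<Rightarrow> ('e \<Rightarrow> 'b) \<Rightarrow> ('e \<times> 'e) set topology"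
  where "dE E p = subtopology (SP2 E p) (Z2_orbit prod.swap ` {(e, e) | e. e \<in> topspace E})"

section \<open>The singular cohomology ring\<close>

text \<open>The sort \<open>{comm_ring, comm_monoid_mult}\<close> of the coefficients describes commutative
  unital rings; unlike \<^class>\<open>comm_ring_1\<close> it does not exclude the zero ring.

  A cochain is an element of the direct sum over all degrees: \<open>c n\<close> is its component of
  degree \<open>n\<close>, given by its values on singular \<open>n\<close>-simplices. Thus \<open>H\<^sup>*\<close> below is the
  direct sum of the \<open>H\<^sup>n\<close>, and classes need not be homogeneous.\<close>

type_synonym ('a, 'r) cochain = "nat \<Rightarrow> ((nat \<Rightarrow> real) \<Rightarrow> 'a) \<Rightarrow> 'r"

definition cochains :: "'a topology \<Rightarrow> ('a, 'r::{comm_ring, comm_monoid_mult}) cochain set"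
  where "cochains X =
    {c. (\<forall>n \<sigma>. \<not> singular_simplex n X \<sigma> \<longrightarrow> c n \<sigma> = 0) \<and> finite {n. \<exists>\<sigma>. c n \<sigma> \<noteq> 0}}"

definition cochain_zero :: "('a, 'r::{comm_ring, comm_monoid_mult}) cochain"
  where "cochain_zero = (\<lambda>n \<sigma>. 0)"

definition cochain_add ::
    "('a, 'r::{comm_ring, comm_monoid_mult}) cochain \<Rightarrow> ('a, 'r) cochain \<Rightarrow> ('a, 'r) cochain"
  where "cochain_add c d = (\<lambda>n \<sigma>. c n \<sigma> + d n \<sigma>)"

definition cochain_coboundary ::
    "'a topology \<Rightarrow> ('a, 'r::{comm_ring, comm_monoid_mult}) cochain \<Rightarrow> ('a, 'r) cochain"
  where "cochain_coboundary X c = (\<lambda>n \<sigma>.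
    if n > 0 \<and> singular_simplex n X \<sigma>
    then \<Sum>k\<le>n. (let r = c (n - 1) (singular_face n k \<sigma>) in if even k then r else - r)
    else 0)"

text \<open>The faces of an \<open>n\<close>-simplex spanned by its vertices \<open>0, \<dots>, i\<close> and \<open>n - j, \<dots>, n\<close>.
  The inclusion of the front face needs no reindexing, because a point of the standard
  \<open>i\<close>-simplex has all coordinates beyond \<open>i\<close> equal to zero.\<close>

definition front_face :: "nat \<Rightarrow> ((nat \<Rightarrow> real) \<Rightarrow> 'a) \<Rightarrow> (nat \<Rightarrow> real) \<Rightarrow> 'a"
  where "front_face i \<sigma> = restrict \<sigma> (standard_simplex i)"

definition back_face :: "nat \<Rightarrow> nat \<Rightarrow> ((nat \<Rightarrow> real) \<Rightarrow> 'a) \<Rightarrow> (nat \<Rightarrow> real) \<Rightarrow> 'a"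
  where "back_face n j \<sigma> =
    restrict (\<lambda>x. \<sigma> (\<lambda>l. if l < n - j then 0 else x (l - (n - j)))) (standard_simplex j)"

definition cochain_cup ::
    "'a topology \<Rightarrow> ('a, 'r::{comm_ring, comm_monoid_mult}) cochain \<Rightarrow> ('a, 'r) cochain
      \<Rightarrow> ('a, 'r) cochain"
  where "cochain_cup X c d = (\<lambda>n \<sigma>.
    if singular_simplex n X \<sigma>
    then \<Sum>i\<le>n. c i (front_face i \<sigma>) * d (n - i) (back_face n (n - i) \<sigma>)
    else 0)"

definition cochain_one :: "'a topology \<Rightarrow> ('a, 'r::{comm_ring, comm_monoid_mult}) cochain"
  where "cochain_one X = (\<lambda>n \<sigma>. if n = 0 \<and> singular_simplex 0 X \<sigma> then 1 else 0)"

definition cocycles :: "'a topology \<Rightarrow> ('a, 'r::{comm_ring, comm_monoid_mult}) cochain set"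
  where "cocycles X = {c \<in> cochains X. cochain_coboundary X c = cochain_zero}"

definition coboundaries :: "'a topology \<Rightarrow> ('a, 'r::{comm_ring, comm_monoid_mult}) cochain set"
  where "coboundaries X = cochain_coboundary X ` cochains X"

definition cocycle_ring ::
    "'a topology \<Rightarrow> ('a, 'r::{comm_ring, comm_monoid_mult}) cochain ring"
  where "cocycle_ring X =
    \<lparr>carrier = cocycles X, mult = cochain_cup X, one = cochain_one X,
     zero = cochain_zero, add = cochain_add\<rparr>"

definition cohomology_ring ::
    "'a topology \<Rightarrow> ('a, 'r::{comm_ring, comm_monoid_mult}) cochain set ring"
  where "cohomology_ring X = cocycle_ring X Quot coboundaries X"

definition cochain_pullback ::
    "'a topology \<Rightarrow> ('a \<Rightarrow> 'b) \<Rightarrow> ('b, 'r::{comm_ring, comm_monoid_mult}) cochain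
      \<Rightarrow> ('a, 'r) cochain"
  where "cochain_pullback X f c =
    (\<lambda>n \<sigma>. if singular_simplex n X \<sigma> then c n (simplex_map n f \<sigma>) else 0)"

text \<open>The map \<open>f\<^sup>*\<close> on classes, in the style of \<^const>\<open>rcoset_mult\<close>: all representatives
  \<open>c\<close> of \<open>u\<close> give the same coset.\<close>

definition cohomology_map ::
    "'a topology \<Rightarrow> ('a \<Rightarrow> 'b) \<Rightarrow> ('b, 'r::{comm_ring, comm_monoid_mult}) cochain set
      \<Rightarrow> ('a, 'r) cochain set"
  where "cohomology_map X f u =
    (\<Union>c\<in>u. coboundaries X +>\<^bsub>cocycle_ring X\<^esub> cochain_pullback X f c)"

text \<open>The ordered product \<open>u 1 \<smile> \<dots> \<smile> u k\<close>; the empty product is the unit.\<close>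

definition cup_product ::
    "'a topology \<Rightarrow> nat \<Rightarrow> (nat \<Rightarrow> ('a, 'r::{comm_ring, comm_monoid_mult}) cochain set)
      \<Rightarrow> ('a, 'r) cochain set"
  where "cup_product X k u =
    foldr (\<lambda>a b. a \<otimes>\<^bsub>cohomology_ring X\<^esub> b) (map u [1..<Suc k]) \<one>\<^bsub>cohomology_ring X\<^esub>"

end

theory Submission
  imports Defs
begin

text \<open>Contracting each fibrewise path to its midpoint shows that, over a set \<open>U\<close> with an
  equivariant section up to homotopy, the inclusion of \<open>U\<close> is equivariantly homotopic to a map into
  the diagonal. On orbit spaces the inclusion of \<open>V = \<rho>(U)\<close> is then homotopic to a map into
  \<open>dE\<^sub>B\<close>, so every class that dies on \<open>dE\<^sub>B\<close> also dies on \<open>V\<close> and is represented by a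
  cocycle vanishing on all simplices in \<open>V\<close>. If there were at most \<open>k\<close> such sets, the product of
  \<open>k\<close> such cocycles, one for each set, would vanish on every simplex lying in some member of the
  cover, and barycentric subdivision makes such a cocycle a coboundary.\<close>

section \<open>Evaluating functions on chains\<close>

text \<open>The usual argument lifts each class to a relative class of \<open>(X, V i)\<close> and
  multiplies. Here relative classes are replaced by honest cocycles that are zero on simplices in
  \<open>V i\<close>, so no long exact sequence occurs and excision is replaced by an explicit
  primitive built from iterated subdivision.

  The price is that homotopy invariance is needed for cocycles. Knowing that homotopic maps send
  cycles to homologous cycles is too weak for this, since cochains are also evaluated on chains that
  are not cycles; a natural chain homotopy, the prism, has to be constructed.

  Classes need not be homogeneous, so the sign in the Leibniz rule cannot be a single factor and
  becomes the operator \<open>cochain_twist\<close>.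

  Passing to orbits is delicate only for the homotopy: the orbit map times the identity of
  \<open>[0,1]\<close> must again be a quotient map, which holds because \<open>[0,1]\<close> is
  locally compact and Hausdorff.

  The bound is \<open>k\<close> because \<open>secat_Z2\<close> counts from zero: a value
  \<open>n < k\<close> means \<open>n + 1 \<le> k\<close> open sets, at least one class for
  each.\<close>

definition chain_eval :: "('x \<Rightarrow> 'r::ab_group_add) \<Rightarrow> ('x \<Rightarrow>\<^sub>0 int) \<Rightarrow> 'r"
  where "chain_eval f =
    (SOME h. (\<forall>x. h (frag_of x) = f x) \<and> (\<forall>a b. h (a + b) = h a + h b))"

text \<open>The universal property of the free abelian group, applied to the additive group of
  \<open>'r\<close>. It justifies the choice in \<open>chain_eval\<close>, the pairing of an
  \<open>'r\<close>-valued cochain with an integral chain; unlike for \<open>frag_extend\<close>,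
  the values are not formal sums.\<close>

lemma chain_eval_exists:
  fixes f :: "'x \<Rightarrow> 'r::ab_group_add"
  shows "\<exists>h. (\<forall>x. h (frag_of x) = f x) \<and> (\<forall>a b. h (a + b) = h a + h b)"
proof -
  let ?G = "\<lparr>carrier = UNIV, mult = (+), one = 0\<rparr> :: 'r monoid"
  have "\<exists>y. y + x = 0" for x :: 'r
    using ab_left_minus by blast
  then interpret comm_group ?G
    by unfold_locales (auto simp: Units_def add_ac)
  obtain h where "h \<in> hom (free_Abelian_group (UNIV :: 'x set)) ?G" "\<And>x. h (frag_of x) = f x"
    using free_Abelian_group_universal[of f UNIV] by auto
  then show ?thesis
    by (intro exI[of _ h]) (auto simp: hom_def free_Abelian_group_def)
qed

lemma chain_eval_of [simp]: "chain_eval f (frag_of x) = f x"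
  and chain_eval_add: "chain_eval f (a + b) = chain_eval f a + chain_eval f b"
  using someI_ex[OF chain_eval_exists[of f]] unfolding chain_eval_def by blast+

lemma chain_eval_0 [simp]: "chain_eval f 0 = 0"
  using chain_eval_add[of f 0 0] by simp

lemma chain_eval_diff: "chain_eval f (a - b) = chain_eval f a - chain_eval f b"
  using chain_eval_add[of f "a - b" b] by simp

lemma chain_eval_minus: "chain_eval f (- a) = - chain_eval f a"
  using chain_eval_diff[of f 0 a] by simp

lemma chain_eval_sum: "chain_eval f (sum g I) = (\<Sum>i\<in>I. chain_eval f (g i))"
  by (induction I rule: infinite_finite_induct) (auto simp: chain_eval_add)

lemma chain_eval_sign:
  "chain_eval f (frag_cmul ((-1) ^ k) x) = (if even k then chain_eval f x else - chain_eval f x)"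
  by (auto simp: chain_eval_minus)

lemma chain_eval_cong:
  assumes "\<And>x. x \<in> Poly_Mapping.keys c \<Longrightarrow> f x = g x"
  shows "chain_eval f c = chain_eval g c"
proof -
  have "Poly_Mapping.keys c \<subseteq> {x. f x = g x}"
    using assms by auto
  then show ?thesis
    by (induction c rule: frag_induction) (auto simp: chain_eval_diff)
qed

lemma chain_eval_zero: "chain_eval (\<lambda>x. 0) c = 0"
proof -
  have "Poly_Mapping.keys c \<subseteq> UNIV" by simp
  then show ?thesis
    by (induction c rule: frag_induction) (auto simp: chain_eval_diff)
qed

lemma chain_eval_eq_0: "(\<And>x. x \<in> Poly_Mapping.keys c \<Longrightarrow> f x = 0) \<Longrightarrow> chain_eval f c = 0"
  using chain_eval_cong[of c f "\<lambda>x. 0"] by (simp add: chain_eval_zero)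

section \<open>The prism operator\<close>

abbreviation simplex_top :: "nat \<Rightarrow> (nat \<Rightarrow> real) topology"
  where "simplex_top n \<equiv> subtopology (powertop_real UNIV) (standard_simplex n)"

abbreviation id_simplex :: "nat \<Rightarrow> (nat \<Rightarrow> real) chain"
  where "id_simplex n \<equiv> frag_of (restrict id (standard_simplex n))"

section \<open>Contractibility of simplices and acyclicity in positive degrees\<close>

lemma contractible_standard_simplex:
  "contractible_space (simplex_top n)"
proof -
  let ?X = "simplex_top n"
  \<comment> \<open>The vertex \<open>0\<close> lies in the standard simplex of every dimension;
    \<open>?h\<close> moves each point to it along a segment, which convexity keeps inside.\<close>
  let ?v = "\<lambda>j::nat. if j = 0 then 1 else (0::real)"
  let ?h = "\<lambda>(t, x). \<lambda>i. (1 - t) * x i + t * ?v i"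
  have "continuous_map (prod_topology unit_interval ?X) euclideanreal
          (\<lambda>z. (1 - fst z) * snd z i + fst z * ?v i)" for i
    by (intro continuous_intros continuous_map_into_fulltopology[OF continuous_map_fst]
         continuous_map_compose[OF continuous_map_snd, unfolded o_def]
         continuous_map_from_subtopology continuous_map_product_projection) auto
  then have "continuous_map (prod_topology unit_interval ?X) (powertop_real UNIV) ?h"
    unfolding continuous_map_componentwise by (auto simp: case_prod_unfold)
  moreover have "?h \<in> topspace (prod_topology unit_interval ?X) \<rightarrow> standard_simplex n"
    using convex_standard_simplex[of _ n ?v] by auto
  ultimately have "continuous_map (prod_topology unit_interval ?X) ?X ?h"
    by (auto simp: continuous_map_in_subtopology)
  then have "homotopic_with (\<lambda>_. True) ?X ?X id (\<lambda>_. ?v)"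
    unfolding homotopic_with_def by (intro exI[of _ ?h]) auto
  then show ?thesis
    unfolding contractible_space_def by blast
qed

text \<open>The contraction makes the cycle homologous to its image under a constant map, and in a
  one-point space every cycle of positive degree bounds. In degree 0 this fails, hence
  \<open>p > 0\<close>.\<close>

lemma contractible_cycle_imp_boundary:
  assumes X: "contractible_space X" and p: "p > 0"
    and c: "singular_chain p X c" "chain_boundary p c = 0"
  shows "\<exists>d. singular_chain (Suc p) X d \<and> chain_boundary (Suc p) d = c"
proof (cases "topspace X = {}")
  case True
  then have "c = 0" using c singular_chain_empty by blast
  then show ?thesis by (intro exI[of _ 0]) auto
next
  case False
  obtain a where a: "homotopic_with (\<lambda>x. True) X X id (\<lambda>x. a)"
    using X by (auto simp: contractible_space_def)
  then have aX: "a \<in> topspace X"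
    using False homotopic_with_imp_continuous_maps[OF a] by (auto simp: continuous_map_def Pi_iff)
  have cyc: "singular_relcycle p X {} c"
    using c by (simp add: singular_cycle)
  have "homotopic_with (\<lambda>h. h \<in> {} \<rightarrow> {}) X X id (\<lambda>x. a)"
    using a by (simp)
  from homotopic_imp_homologous_rel_chain_maps[OF this cyc]
  have 1: "homologous_rel p X {} c (chain_map p (\<lambda>x. a) c)"
    using c by (simp add: chain_map_ident)
  let ?A = "subtopology X {a}"
  have "singular_relcycle p ?A {} (chain_map p (\<lambda>x. a) c)"
    by (rule singular_relcycle_chain_map[OF cyc]) (use aX in \<open>auto simp: continuous_map_in_subtopology\<close>)
  moreover have "topspace ?A = {a}" using aX by auto
  ultimately have "singular_relboundary p ?A {} (chain_map p (\<lambda>x. a) c)"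
    using singular_boundary_eq_cycle_singleton[of ?A a p] p by simp
  then have "singular_relboundary p X {} (chain_map p (\<lambda>x. a) c)"
    unfolding singular_boundary using singular_chain_subtopology by blast
  with 1 have "singular_relboundary p X {} c"
    unfolding homologous_rel_def
    using singular_relboundary_add by fastforce
  then show ?thesis
    by (simp add: singular_boundary)
qed

section \<open>The prism by acyclic models\<close>

definition cylinder_map :: "(real \<times> 'a \<Rightarrow> 'b) \<Rightarrow> ((nat \<Rightarrow> real) \<Rightarrow> 'a) \<Rightarrow> real \<times> (nat \<Rightarrow> real) \<Rightarrow> 'b"
  where "cylinder_map h \<sigma> = (\<lambda>(t, x). h (t, \<sigma> x))"

text \<open>The model chain \<open>q\<close> on the cylinder over the standard simplex is a
  parameter, so that the recursion for \<open>prism_chain\<close> can use the operator and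
  naturality can be proved for every \<open>q\<close>.\<close>

definition prism_operator ::
    "nat \<Rightarrow> (real \<times> (nat \<Rightarrow> real)) chain \<Rightarrow> (real \<times> 'a \<Rightarrow> 'b) \<Rightarrow> 'a chain \<Rightarrow> 'b chain"
  where "prism_operator n q h c = frag_extend (\<lambda>\<sigma>. chain_map (Suc n) (cylinder_map h \<sigma>) q) c"

definition cylinder_ends :: "nat \<Rightarrow> (real \<times> (nat \<Rightarrow> real)) chain"
  where "cylinder_ends n =
    chain_map n (Pair 1) (id_simplex n) - chain_map n (Pair 0) (id_simplex n)"

text \<open>The prism is built by acyclic models: over the standard simplex any chain with the correct
  boundary will do, and one exists because the cylinder over the simplex is contractible.\<close>

primrec prism_chain :: "nat \<Rightarrow> (real \<times> (nat \<Rightarrow> real)) chain"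
  where "prism_chain 0 =
    (SOME q. singular_chain (Suc 0) (prod_topology unit_interval (simplex_top 0)) q \<and>
       chain_boundary (Suc 0) q = cylinder_ends 0)"
  | "prism_chain (Suc n) =
    (SOME q. singular_chain (Suc (Suc n)) (prod_topology unit_interval (simplex_top (Suc n))) q \<and>
       chain_boundary (Suc (Suc n)) q = cylinder_ends (Suc n)
         - prism_operator n (prism_chain n) id (chain_boundary (Suc n) (id_simplex (Suc n))))"

definition prism :: "nat \<Rightarrow> (real \<times> 'a \<Rightarrow> 'b) \<Rightarrow> 'a chain \<Rightarrow> 'b chain"
  where "prism n = prism_operator n (prism_chain n)"

lemma singular_chain_id_simplex: "singular_chain n (simplex_top n) (id_simplex n)"
  by (simp add: simplicial_imp_singular_simplex singular_chain_of)

lemma continuous_map_cylinder_map: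
  assumes "continuous_map (prod_topology unit_interval X) Y h" "singular_simplex n X \<sigma>"
  shows "continuous_map (prod_topology unit_interval (simplex_top n)) Y (cylinder_map h \<sigma>)"
proof -
  have "continuous_map (prod_topology unit_interval (simplex_top n)) (prod_topology unit_interval X)
     (\<lambda>(t, x). (t, \<sigma> x))"
    using assms by (simp add: continuous_map_prod_top singular_simplex_def)
  from continuous_map_compose[OF this assms(1)] show ?thesis
    by (simp add: o_def cylinder_map_def case_prod_unfold)
qed

lemma singular_chain_prism_operator:
  assumes h: "continuous_map (prod_topology unit_interval X) Y h" and c: "singular_chain n X c"
    and q: "singular_chain (Suc n) (prod_topology unit_interval (simplex_top n)) q"
  shows "singular_chain (Suc n) Y (prism_operator n q h c)"
  unfolding prism_operator_def
proof (rule singular_chain_extend)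
  fix \<sigma> assume "\<sigma> \<in> Poly_Mapping.keys c"
  then have "singular_simplex n X \<sigma>" using c by (auto simp: singular_chain_def)
  then show "singular_chain (Suc n) Y (chain_map (Suc n) (cylinder_map h \<sigma>) q)"
    using continuous_map_cylinder_map[OF h] singular_chain_chain_map[OF q] by blast
qed

lemma prism_operator_diff:
  "prism_operator n q h (a - b) = prism_operator n q h a - prism_operator n q h b"
  by (simp add: prism_operator_def frag_extend_diff)

text \<open>Naturality in the source. The two cylinder maps agree only on the cylinder itself, as
  \<open>simplex_map\<close> is restricted to the simplex; this is why \<open>q\<close> must be a
  chain there.\<close>

lemma prism_operator_chain_map:
  assumes "singular_chain n Z c" "singular_chain (Suc n) (prod_topology unit_interval (simplex_top n)) q"
  shows "prism_operator n q h (chain_map n g c) = prism_operator n q (\<lambda>(t, z). h (t, g z)) c"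
  using assms(1) unfolding singular_chain_def
proof (induction c rule: frag_induction)
  case (one \<sigma>)
  have "chain_map (Suc n) (cylinder_map h (simplex_map n g \<sigma>)) q
      = chain_map (Suc n) (cylinder_map (\<lambda>(t, z). h (t, g z)) \<sigma>) q"
    by (rule chain_map_eq[OF assms(2)]) (auto simp: cylinder_map_def simplex_map_def)
  then show ?case by (simp add: prism_operator_def)
qed (auto simp: prism_operator_def frag_extend_diff chain_map_diff)

text \<open>Naturality in the target. With \<open>h = id\<close> on a model cylinder it presents
  every prism as the image of a universal one.\<close>

lemma chain_map_prism_operator:
  "chain_map (Suc n) g (prism_operator n q h c) = prism_operator n q (g \<circ> h) c"
proof -
  have "Poly_Mapping.keys c \<subseteq> UNIV" by simp
  then show ?thesis
  proof (induction c rule: frag_induction)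
    case (one \<sigma>)
    have "cylinder_map (g \<circ> h) \<sigma> = g \<circ> cylinder_map h \<sigma>"
      by (auto simp: cylinder_map_def fun_eq_iff)
    then show ?case
      by (simp add: prism_operator_def chain_map_compose del: o_apply) simp
  qed (auto simp: prism_operator_def frag_extend_diff chain_map_diff)
qed

definition prism_chain_spec :: "nat \<Rightarrow> bool"
  where "prism_chain_spec n \<longleftrightarrow>
    singular_chain (Suc n) (prod_topology unit_interval (simplex_top n)) (prism_chain n) \<and>
    chain_boundary (Suc n) (prism_chain n) = cylinder_ends n -
      (if n = 0 then 0 else prism (n - 1) id (chain_boundary n (id_simplex n)))"

text \<open>Pushing the model identity forward along the cylinder over \<open>\<sigma>\<close> gives
  the formula for \<open>\<sigma>\<close>. The specification is assumed only up to degree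
  \<open>n\<close>, so that the lemma can serve inside the induction that proves it.\<close>

lemma chain_boundary_prism_aux:
  assumes spec: "\<And>m. m \<le> n \<Longrightarrow> prism_chain_spec m"
    and h: "continuous_map (prod_topology unit_interval X) Y h" and c: "singular_chain n X c"
  shows "chain_boundary (Suc n) (prism n h c) =
    chain_map n (\<lambda>x. h (1, x)) c - chain_map n (\<lambda>x. h (0, x)) c -
      (if n = 0 then 0 else prism (n - 1) h (chain_boundary n c))"
  using c unfolding singular_chain_def
proof (induction c rule: frag_induction)
  case (one \<sigma>)
  then have \<sigma>: "singular_simplex n X \<sigma>" by simp
  let ?k = "cylinder_map h \<sigma>"
  have ends: "chain_map n ?k (chain_map n (Pair t) (id_simplex n)) = chain_map n (\<lambda>x. h (t, x)) (frag_of \<sigma>)" for t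
    by (auto simp: simplex_map_def cylinder_map_def intro!: restrict_ext arg_cong[where f = frag_of])
  \<comment> \<open>The faces of \<open>\<sigma>\<close> are the images under
    \<open>\<sigma>\<close> of the faces of the identity simplex; naturality in the source and then
    in the target moves the prism across.\<close>
  have rest: "chain_map n ?k (prism (n - 1) id (chain_boundary n (id_simplex n)))
      = prism (n - 1) h (chain_boundary n (frag_of \<sigma>))" if n: "n \<noteq> 0"
  proof -
    obtain m where m: "n = Suc m" using n not0_implies_Suc by auto
    let ?q = "prism_chain m"
    have "chain_boundary n (frag_of \<sigma>) = chain_boundary n (chain_map n \<sigma> (id_simplex n))"
      using \<sigma> by (metis singular_simplex_chain_map_id)
    also have "\<dots> = chain_map m \<sigma> (chain_boundary n (id_simplex n))"
      using chain_boundary_chain_map[OF singular_chain_id_simplex, of n \<sigma>] m by simp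
    finally have 1: "chain_boundary n (frag_of \<sigma>) = chain_map m \<sigma> (chain_boundary n (id_simplex n))" .
    have 2: "singular_chain m (simplex_top n) (chain_boundary n (id_simplex n))"
      using singular_chain_boundary[OF singular_chain_id_simplex[of n]] m by simp
    have "prism_operator m ?q h (chain_map m \<sigma> (chain_boundary n (id_simplex n)))
        = prism_operator m ?q ?k (chain_boundary n (id_simplex n))"
      using prism_operator_chain_map[OF 2, of ?q h \<sigma>] spec[of m] m
      by (simp add: prism_chain_spec_def cylinder_map_def)
    then show ?thesis
      using chain_map_prism_operator[of m ?k ?q id] using 1 by (simp add: m prism_def)
  qed
  have "chain_boundary (Suc n) (prism n h (frag_of \<sigma>)) = chain_map n ?k (chain_boundary (Suc n) (prism_chain n))"
    using spec[of n] chain_boundary_chain_map[of "Suc n" _ "prism_chain n" ?k]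
    by (auto simp: prism_chain_spec_def prism_def prism_operator_def)
  also have "\<dots> = chain_map n ?k (cylinder_ends n) -
      (if n = 0 then 0 else prism (n - 1) h (chain_boundary n (frag_of \<sigma>)))"
    using spec[of n] rest by (simp add: prism_chain_spec_def chain_map_diff)
  finally show ?case
    by (simp only: cylinder_ends_def chain_map_diff ends)
qed (auto simp: prism_def prism_operator_def frag_extend_diff chain_boundary_diff chain_map_diff)

lemma prism_chain_spec: "prism_chain_spec n"
proof (induction n rule: less_induct)
  case (less k)
  show ?case
  proof (cases k)
  case 0
  let ?M = "prod_topology unit_interval (simplex_top 0)"
  \<comment> \<open>Degree 0 is out of reach of \<open>contractible_cycle_imp_boundary\<close>.
    Instead, the identity of the cylinder is itself a homotopy between the inclusions of its two
    ends.\<close>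
  have "continuous_map (prod_topology unit_interval (simplex_top 0)) ?M id" by simp
  then have "homotopic_with (\<lambda>h. h \<in> {} \<rightarrow> {}) (simplex_top 0) ?M (Pair 0) (Pair 1)"
    unfolding homotopic_with_def by (intro exI[of _ id]) auto
  then have "homotopic_with (\<lambda>h. h \<in> {} \<rightarrow> {}) (simplex_top 0) ?M (Pair 1) (Pair 0)"
    by (rule homotopic_with_symD)
  moreover have "singular_relcycle 0 (simplex_top 0) {} (id_simplex 0)"
    by (simp add: singular_cycle singular_chain_id_simplex chain_boundary_def)
  ultimately have "homologous_rel 0 ?M {} (chain_map 0 (Pair 1) (id_simplex 0)) (chain_map 0 (Pair 0) (id_simplex 0))"
    by (rule homotopic_imp_homologous_rel_chain_maps)
  then have "\<exists>q. singular_chain (Suc 0) ?M q \<and> chain_boundary (Suc 0) q = cylinder_ends 0"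
    by (simp add: homologous_rel_def singular_boundary cylinder_ends_def)
  from someI_ex[OF this] show ?thesis
    by (simp add: prism_chain_spec_def 0)
next
  case (Suc n)
  have IH: "\<And>m. m \<le> n \<Longrightarrow> prism_chain_spec m"
    using less Suc by simp
  let ?M = "prod_topology unit_interval (simplex_top (Suc n))"
  let ?i = "id_simplex (Suc n)"
  let ?z = "cylinder_ends (Suc n) - prism n id (chain_boundary (Suc n) ?i)"
  have i: "singular_chain (Suc n) (simplex_top (Suc n)) ?i"
    by (rule singular_chain_id_simplex)
  then have di: "singular_chain n (simplex_top (Suc n)) (chain_boundary (Suc n) ?i)"
    by (rule singular_chain_boundary_alt)
  have idM: "continuous_map ?M ?M id" by simp
  have z: "singular_chain (Suc n) ?M ?z"
    unfolding cylinder_ends_def prism_def using IH[of n]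
    by (intro singular_chain_diff singular_chain_chain_map[OF i] singular_chain_prism_operator[OF idM di])
       (auto simp: continuous_map_paired prism_chain_spec_def)
  \<comment> \<open>\<open>?z\<close> is a cycle: the boundary of the ends cancels against the
    boundary formula one degree lower, applied to the boundary of the simplex, whose own boundary is
    zero.\<close>
  have "chain_boundary (Suc n) (cylinder_ends (Suc n)) =
     chain_map n (Pair 1) (chain_boundary (Suc n) ?i) - chain_map n (Pair 0) (chain_boundary (Suc n) ?i)"
    by (simp add: cylinder_ends_def chain_boundary_diff chain_boundary_chain_map[OF i] del: chain_map_of)
  moreover have "chain_boundary n (chain_boundary (Suc n) ?i) = 0"
    using chain_boundary_boundary_alt[OF i] by simp
  ultimately have "chain_boundary (Suc n) ?z = 0"
    using chain_boundary_prism_aux[OF IH idM di]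
    by (simp add: chain_boundary_diff id_def prism_def prism_operator_def)
  moreover have "contractible_space ?M"
    using contractible_standard_simplex by (auto simp: contractible_space_prod_topology convex_imp_contractible)
  ultimately have "\<exists>q. singular_chain (Suc (Suc n)) ?M q \<and> chain_boundary (Suc (Suc n)) q = ?z"
    using contractible_cycle_imp_boundary[of ?M "Suc n" ?z] z by simp
  from someI_ex[OF this] show ?thesis
    by (simp add: prism_chain_spec_def prism_def Suc)
  qed
qed

lemma chain_boundary_prism:
  assumes "continuous_map (prod_topology unit_interval X) Y h" "singular_chain n X c"
  shows "chain_boundary (Suc n) (prism n h c) =
    chain_map n (\<lambda>x. h (1, x)) c - chain_map n (\<lambda>x. h (0, x)) c -
      (if n = 0 then 0 else prism (n - 1) h (chain_boundary n c))"
  using chain_boundary_prism_aux[OF prism_chain_spec assms] .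

lemma singular_chain_prism:
  assumes "continuous_map (prod_topology unit_interval X) Y h" "singular_chain n X c"
  shows "singular_chain (Suc n) Y (prism n h c)"
  using singular_chain_prism_operator[OF assms] prism_chain_spec[of n]
  by (simp add: prism_def prism_chain_spec_def)

section \<open>Cochains\<close>

lemma cochain_zero_in_cochains [simp]: "cochain_zero \<in> cochains X"
  by (simp add: cochains_def cochain_zero_def)

lemma cochains_eq_0: "c \<in> cochains X \<Longrightarrow> \<not> singular_simplex n X \<sigma> \<Longrightarrow> c n \<sigma> = 0"
  by (simp add: cochains_def)

lemma cochains_finite: "c \<in> cochains X \<Longrightarrow> finite {n. \<exists>\<sigma>. c n \<sigma> \<noteq> 0}"
  by (simp add: cochains_def)

lemma cochainsI:
  assumes "\<And>n \<sigma>. \<not> singular_simplex n X \<sigma> \<Longrightarrow> c n \<sigma> = 0"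
    and "finite S" "\<And>n \<sigma>. n \<notin> S \<Longrightarrow> c n \<sigma> = 0"
  shows "c \<in> cochains X"
  unfolding cochains_def using assms by (auto intro!: finite_subset[OF _ assms(2)])

lemma cochain_add_in_cochains:
  assumes "c \<in> cochains X" "d \<in> cochains X"
  shows "cochain_add c d \<in> cochains X"
  by (rule cochainsI[where S = "{n. \<exists>\<sigma>. c n \<sigma> \<noteq> 0} \<union> {n. \<exists>\<sigma>. d n \<sigma> \<noteq> 0}"])
     (use assms in \<open>auto simp: cochain_add_def cochains_eq_0 cochains_finite\<close>)

definition cochain_uminus :: "('a, 'r::{comm_ring, comm_monoid_mult}) cochain \<Rightarrow> ('a, 'r) cochain"
  where "cochain_uminus c = (\<lambda>n \<sigma>. - c n \<sigma>)"

lemma cochain_uminus_in_cochains: "c \<in> cochains X \<Longrightarrow> cochain_uminus c \<in> cochains X"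
  by (auto simp: cochains_def cochain_uminus_def)

text \<open>The alternating sum is the pairing with the boundary chain. Through this form,
  identities about boundaries of chains turn into identities about coboundaries.\<close>

lemma coboundary_eval:
  "cochain_coboundary X c (Suc n) \<sigma> =
    (if singular_simplex (Suc n) X \<sigma> then chain_eval (c n) (chain_boundary (Suc n) (frag_of \<sigma>)) else 0)"
  by (simp add: cochain_coboundary_def chain_boundary_of chain_eval_add chain_eval_sum chain_eval_sign chain_eval_minus
      Let_def cong: if_cong)

lemma coboundary_0 [simp]: "cochain_coboundary X c 0 \<sigma> = 0"
  by (simp add: cochain_coboundary_def)

lemma chain_eval_boundary:
  assumes "singular_chain (Suc n) X x"
  shows "chain_eval (c n) (chain_boundary (Suc n) x) = chain_eval (cochain_coboundary X c (Suc n)) x"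
  using assms unfolding singular_chain_def
  by (induction x rule: frag_induction)
     (auto simp: coboundary_eval chain_boundary_diff chain_eval_diff)

lemma coboundary_in_cochains:
  assumes "c \<in> cochains X"
  shows "cochain_coboundary X c \<in> cochains X"
proof (rule cochainsI[where S = "Suc ` {n. \<exists>\<sigma>. c n \<sigma> \<noteq> 0}"])
  show "finite (Suc ` {n. \<exists>\<sigma>. c n \<sigma> \<noteq> 0})"
    using assms by (simp add: cochains_finite)
  fix n \<sigma>
  show "cochain_coboundary X c n \<sigma> = 0" if "\<not> singular_simplex n X \<sigma>"
    using that by (simp add: cochain_coboundary_def)
  show "cochain_coboundary X c n \<sigma> = 0" if "n \<notin> Suc ` {n. \<exists>\<sigma>. c n \<sigma> \<noteq> 0}"
    using that by (cases n) (auto simp: coboundary_eval intro!: chain_eval_eq_0)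
qed

lemma coboundary_add:
  "cochain_coboundary X (cochain_add c d) =
    cochain_add (cochain_coboundary X c) (cochain_coboundary X d)"
proof (intro ext)
  fix n \<sigma>
  have *: "chain_eval (\<lambda>\<sigma>. f \<sigma> + g \<sigma>) x = chain_eval f x + chain_eval g x"
    for f g :: "((nat \<Rightarrow> real) \<Rightarrow> 'a) \<Rightarrow> 'b" and x
  proof -
    have "Poly_Mapping.keys x \<subseteq> UNIV" by simp
    then show ?thesis
      by (induction x rule: frag_induction) (auto simp: chain_eval_diff)
  qed
  show "cochain_coboundary X (cochain_add c d) n \<sigma> =
    cochain_add (cochain_coboundary X c) (cochain_coboundary X d) n \<sigma>"
    by (cases n) (simp_all add: cochain_add_def coboundary_eval *)
qed

lemma coboundary_uminus:
  "cochain_coboundary X (cochain_uminus c) = cochain_uminus (cochain_coboundary X c)"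
proof (intro ext)
  fix n \<sigma>
  have *: "chain_eval (\<lambda>\<sigma>. - f \<sigma>) x = - chain_eval f x" for f :: "((nat \<Rightarrow> real) \<Rightarrow> 'a) \<Rightarrow> 'b" and x
  proof -
    have "Poly_Mapping.keys x \<subseteq> UNIV" by simp
    then show ?thesis
      by (induction x rule: frag_induction) (auto simp: chain_eval_diff)
  qed
  show "cochain_coboundary X (cochain_uminus c) n \<sigma> = cochain_uminus (cochain_coboundary X c) n \<sigma>"
    by (cases n) (simp_all add: cochain_uminus_def coboundary_eval *)
qed

lemma coboundary_cochain_zero [simp]: "cochain_coboundary X cochain_zero = cochain_zero"
proof (intro ext)
  fix n \<sigma>
  show "cochain_coboundary X cochain_zero n \<sigma> = cochain_zero n \<sigma>"
    by (cases n) (simp_all add: coboundary_eval cochain_zero_def chain_eval_zero)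
qed

lemma coboundary_coboundary [simp]:
  "cochain_coboundary X (cochain_coboundary X c) = cochain_zero"
proof (intro ext)
  fix n \<sigma>
  have "cochain_coboundary X (cochain_coboundary X c) (Suc (Suc m)) \<sigma> = 0"
    if \<sigma>: "singular_simplex (Suc (Suc m)) X \<sigma>" for m
  proof -
    have s: "singular_chain (Suc (Suc m)) X (frag_of \<sigma>)"
      using \<sigma> by (simp add: singular_chain_of)
    have "cochain_coboundary X (cochain_coboundary X c) (Suc (Suc m)) \<sigma> =
        chain_eval (cochain_coboundary X c (Suc m)) (chain_boundary (Suc (Suc m)) (frag_of \<sigma>))"
      using \<sigma> by (simp add: coboundary_eval)
    also have "\<dots> = chain_eval (c m) (chain_boundary (Suc m) (chain_boundary (Suc (Suc m)) (frag_of \<sigma>)))"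
      using chain_eval_boundary[OF singular_chain_boundary_alt[OF s], of c] by simp
    also have "\<dots> = 0"
      using chain_boundary_boundary_alt[OF s] by simp
    finally show ?thesis .
  qed
  moreover have "cochain_coboundary X (cochain_coboundary X c) (Suc 0) \<sigma> = 0"
  proof -
    have "chain_eval (cochain_coboundary X c 0) x = 0" for x
      by (rule chain_eval_eq_0) simp
    then show ?thesis by (simp add: coboundary_eval)
  qed
  ultimately show "cochain_coboundary X (cochain_coboundary X c) n \<sigma> = cochain_zero n \<sigma>"
    by (cases n rule: nat.exhaust; cases "n - 1" rule: nat.exhaust)
       (auto simp: cochain_zero_def coboundary_eval[of _ _ "Suc _"])
qed

lemma coboundary_subtopology:
  assumes "singular_simplex n (subtopology X V) \<sigma>"
  shows "cochain_coboundary (subtopology X V) c n \<sigma> = cochain_coboundary X c n \<sigma>"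
  using assms by (simp add: cochain_coboundary_def singular_simplex_subtopology)

lemma coboundary_pullback:
  assumes "continuous_map X Y f"
  shows "cochain_pullback X f (cochain_coboundary Y c) = cochain_coboundary X (cochain_pullback X f c)"
proof (intro ext)
  fix n \<sigma>
  have "singular_face n k (simplex_map n f \<sigma>) = simplex_map (n - Suc 0) f (singular_face n k \<sigma>)"
    if "n > 0" "k \<le> n" for k
    using that by (fastforce simp: singular_face_def simplex_map_def simplical_face_in_standard_simplex)
  then show "cochain_pullback X f (cochain_coboundary Y c) n \<sigma> =
      cochain_coboundary X (cochain_pullback X f c) n \<sigma>"
    using singular_simplex_simplex_map[OF _ assms] singular_simplex_singular_face[of n X \<sigma>]
    by (auto simp: cochain_coboundary_def cochain_pullback_def Let_def Suc_le_eq intro!: sum.cong)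
qed

lemma cochain_pullback_in_cochains:
  assumes "c \<in> cochains Y"
  shows "cochain_pullback X f c \<in> cochains X"
  by (rule cochainsI[where S = "{n. \<exists>\<sigma>. c n \<sigma> \<noteq> 0}"])
     (use assms in \<open>auto simp: cochain_pullback_def cochains_finite\<close>)

lemma cocycles_add_coboundary:
  assumes "c \<in> cocycles X" "b \<in> cochains X"
  shows "cochain_add c (cochain_coboundary X b) \<in> cocycles X"
  using assms by (auto simp: cocycles_def coboundary_add cochain_add_in_cochains coboundary_in_cochains)
     (simp add: cochain_add_def cochain_zero_def)

text \<open>The cochain \<open>\<sigma> \<mapsto> a (prism \<sigma>)\<close> does it, since the cocycle \<open>a\<close> vanishes on the
  boundary of the prism.\<close>

lemma pullback_homotopic:
  fixes a :: "('b, 'r::{comm_ring, comm_monoid_mult}) cochain"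
  assumes hom: "homotopic_with (\<lambda>_. True) X Y f g" and a: "a \<in> cocycles Y"
  obtains b where "b \<in> cochains X"
    "cochain_pullback X g a = cochain_add (cochain_pullback X f a) (cochain_coboundary X b)"
proof -
  obtain h where h: "continuous_map (prod_topology unit_interval X) Y h"
    and h0: "(\<lambda>x. h (0, x)) = f" and h1: "(\<lambda>x. h (1, x)) = g"
    using hom unfolding homotopic_with_def by fastforce
  have aC: "a \<in> cochains Y" and da: "cochain_coboundary Y a = cochain_zero"
    using a by (auto simp: cocycles_def)
  define b where
    "b = (\<lambda>n \<sigma>. if singular_simplex n X \<sigma> then chain_eval (a (Suc n)) (prism n h (frag_of \<sigma>)) else 0)"
  have "finite (Suc -` {n. \<exists>\<sigma>. a n \<sigma> \<noteq> 0})"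
    using cochains_finite[OF aC] by (rule finite_vimageI) auto
  then have "b \<in> cochains X"
    by (rule cochainsI[rotated]) (auto simp: b_def intro!: chain_eval_eq_0)
  moreover have "cochain_pullback X g a = cochain_add (cochain_pullback X f a) (cochain_coboundary X b)"
  proof (intro ext)
    fix n \<sigma>
    show "cochain_pullback X g a n \<sigma> = cochain_add (cochain_pullback X f a) (cochain_coboundary X b) n \<sigma>"
    proof (cases "singular_simplex n X \<sigma>")
      case True
      then have s: "singular_chain n X (frag_of \<sigma>)"
        by (simp add: singular_chain_of)
      have "chain_eval (a n) (chain_boundary (Suc n) (prism n h (frag_of \<sigma>))) = 0"
        using chain_eval_boundary[OF singular_chain_prism[OF h s], of a] da
        by (simp add: cochain_zero_def chain_eval_zero)
      then have 1: "a n (simplex_map n g \<sigma>) = a n (simplex_map n f \<sigma>) +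
          chain_eval (a n) (if n = 0 then 0 else prism (n - 1) h (chain_boundary n (frag_of \<sigma>)))"
        unfolding chain_boundary_prism[OF h s]
        by (auto simp: h0 h1 chain_eval_diff diff_eq_eq add.commute)
      have "cochain_coboundary X b n \<sigma> =
          chain_eval (a n) (if n = 0 then 0 else prism (n - 1) h (chain_boundary n (frag_of \<sigma>)))"
      proof (cases n)
        case (Suc m)
        have c: "singular_chain m X (chain_boundary n (frag_of \<sigma>))"
          using singular_chain_boundary[OF s] Suc by simp
        \<comment> \<open>The boundary of \<open>\<sigma>\<close> is not a simplex, so the defining
          formula of \<open>b\<close> is first extended additively to chains.\<close>
        have "chain_eval (b m) c = chain_eval (a n) (prism m h c)" if "singular_chain m X c" for c
          using that unfolding singular_chain_def
          by (induction c rule: frag_induction)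
             (auto simp: b_def Suc chain_eval_diff prism_def prism_operator_diff,
              simp_all add: prism_operator_def)
        from this[OF c] show ?thesis
          using True by (simp add: Suc coboundary_eval)
      qed simp
      then show ?thesis
        using 1 True by (simp add: cochain_add_def cochain_pullback_def)
    qed (simp add: cochain_pullback_def cochain_add_def cochain_coboundary_def)
  qed
  ultimately show thesis by (rule that)
qed

section \<open>The Leibniz rule for the cup product\<close>

text \<open>The sign \<open>(-1)^k\<close> as an operation on values, meaningful in any abelian
  group.\<close>

definition signed :: "nat \<Rightarrow> 'r::ab_group_add \<Rightarrow> 'r"
  where "signed k r = (if even k then r else - r)"

lemma signed_sum: "signed k (sum f I) = (\<Sum>i\<in>I. signed k (f i))"
  by (simp add: signed_def sum_negf)

lemma signed_mult_left: "signed k (r::'r::ring) * s = signed k (r * s)"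
  and signed_mult_right: "r * signed k s = signed k (r * s)"
  and signed_0 [simp]: "signed k (0::'r) = 0"
  and signed_signed: "signed k (signed l r) = signed (k + l) r"
  by (auto simp: signed_def)

text \<open>The grading involution. It carries the sign of the Leibniz rule for inhomogeneous
  cochains.\<close>

definition cochain_twist :: "('a, 'r::{comm_ring, comm_monoid_mult}) cochain \<Rightarrow> ('a, 'r) cochain"
  where "cochain_twist c = (\<lambda>n \<sigma>. signed n (c n \<sigma>))"

lemma coboundary_signed:
  "singular_simplex (Suc n) X \<sigma> \<Longrightarrow>
    cochain_coboundary X c (Suc n) \<sigma> = (\<Sum>k\<le>Suc n. signed k (c n (singular_face (Suc n) k \<sigma>)))"
  by (auto simp: cochain_coboundary_def signed_def Let_def intro!: sum.cong)

section \<open>Front and back faces of a simplex with one vertex deleted\<close>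

lemma continuous_map_simplex_shift:
  "continuous_map (subtopology (powertop_real UNIV) S) (powertop_real UNIV)
    (\<lambda>x l. if l < m then 0 else x (l - m))"
  unfolding continuous_map_componentwise
  by (auto intro!: continuous_map_from_subtopology continuous_map_product_projection)

lemma simplex_shift_in_standard_simplex:
  assumes "x \<in> standard_simplex j" "j + m = n"
  shows "(\<lambda>l. if l < m then 0 else x (l - m)) \<in> standard_simplex n"
proof -
  have "(\<Sum>l\<le>n. if l < m then 0 else x (l - m)) = (\<Sum>l\<in>{0 + m..j + m}. if l < m then 0 else x (l - m))"
    using assms(2) by (intro sum.mono_neutral_right) auto
  also have "\<dots> = (\<Sum>l\<le>j. x l)"
    unfolding sum.shift_bounds_cl_nat_ivl by (simp add: atLeast0AtMost)
  finally show ?thesis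
    using assms by (auto simp: standard_simplex_def)
qed

lemma singular_simplex_front_face:
  assumes "singular_simplex n X \<sigma>" "i \<le> n"
  shows "singular_simplex i X (front_face i \<sigma>)"
  using assms standard_simplex_mono[OF assms(2)]
  by (auto simp: singular_simplex_def front_face_def intro: continuous_map_from_subtopology_mono)

lemma singular_simplex_back_face:
  assumes \<sigma>: "singular_simplex n X \<sigma>" and j: "j \<le> n"
  shows "singular_simplex j X (back_face n j \<sigma>)"
proof -
  let ?s = "\<lambda>x l. if l < n - j then 0 else x (l - (n - j))"
  have "continuous_map (simplex_top j) (simplex_top n) ?s"
    using j continuous_map_simplex_shift[of "standard_simplex j" "n - j"]
    by (auto simp: continuous_map_in_subtopology intro!: simplex_shift_in_standard_simplex)
  then have "continuous_map (simplex_top j) X (\<sigma> \<circ> ?s)"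
    using \<sigma> continuous_map_compose by (auto simp: singular_simplex_def)
  then show ?thesis
    by (simp add: singular_simplex_def back_face_def o_def)
qed

text \<open>For \<open>k \<le> i\<close> the deleted vertex is one of \<open>0, ..., i + 1\<close>,
  and the remaining \<open>i + 1\<close> of these span the front face.\<close>

lemma front_face_singular_face_le:
  assumes "k \<le> i" "i \<le> n"
  shows "front_face i (singular_face (Suc n) k \<sigma>) = singular_face (Suc i) k (front_face (Suc i) \<sigma>)"
proof (rule ext)
  fix x
  have "simplical_face k x \<in> standard_simplex (Suc i)" if "x \<in> standard_simplex i"
    using that assms simplical_face_in_standard_simplex[of "Suc i" k x] by simp
  moreover have "standard_simplex i \<subseteq> standard_simplex n"
    using assms standard_simplex_mono by blast
  ultimately show "front_face i (singular_face (Suc n) k \<sigma>) x = singular_face (Suc i) k (front_face (Suc i) \<sigma>) x"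
    by (auto simp: front_face_def singular_face_def)
qed

lemma front_face_singular_face_gt:
  assumes "i < k" "i \<le> n"
  shows "front_face i (singular_face (Suc n) k \<sigma>) = front_face i \<sigma>"
proof (rule ext)
  fix x
  have "simplical_face k x = x" if "x \<in> standard_simplex i"
    using that assms by (auto simp: simplical_face_def standard_simplex_def fun_eq_iff)
  moreover have "standard_simplex i \<subseteq> standard_simplex n"
    using assms standard_simplex_mono by blast
  ultimately show "front_face i (singular_face (Suc n) k \<sigma>) x = front_face i \<sigma> x"
    by (auto simp: front_face_def singular_face_def)
qed

lemma back_face_singular_face_le:
  assumes "k \<le> i" "i \<le> n"
  shows "back_face n (n - i) (singular_face (Suc n) k \<sigma>) = back_face (Suc n) (n - i) \<sigma>"
proof (rule ext)
  fix x
  let ?s = "\<lambda>m x l. if l < m then 0 else x (l - m)"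
  have "?s i x \<in> standard_simplex n" if "x \<in> standard_simplex (n - i)"
    using simplex_shift_in_standard_simplex[OF that, of i n] assms by simp
  moreover have "simplical_face k (?s i x) = ?s (Suc i) x"
    using assms by (auto simp: simplical_face_def fun_eq_iff)
  moreover have shifts: "n - (n - i) = i" "Suc n - (n - i) = Suc i" "Suc n - (Suc n - i) = i"
    using assms by auto
  ultimately show "back_face n (n - i) (singular_face (Suc n) k \<sigma>) x = back_face (Suc n) (n - i) \<sigma> x"
    using assms unfolding back_face_def singular_face_def shifts by (simp add: Suc_diff_le)
qed

text \<open>For \<open>i < k\<close> the deleted vertex is one of \<open>i, ..., n + 1\<close>. In
  the back face spanned by them the numbering starts at vertex \<open>i\<close>, hence the index
  \<open>k - i\<close>.\<close>

lemma back_face_singular_face_gt: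
  assumes "i < k" "k \<le> Suc n"
  shows "back_face n (n - i) (singular_face (Suc n) k \<sigma>) =
    singular_face (Suc n - i) (k - i) (back_face (Suc n) (Suc n - i) \<sigma>)"
proof (rule ext)
  fix x
  let ?s = "\<lambda>x l. if l < i then 0 else x (l - i)"
  have "?s x \<in> standard_simplex n" if "x \<in> standard_simplex (n - i)"
    using simplex_shift_in_standard_simplex[OF that, of i n] assms by simp
  moreover have "simplical_face k (?s x) = ?s (simplical_face (k - i) x)"
    using assms by (auto simp: simplical_face_def fun_eq_iff)
  moreover have "simplical_face (k - i) x \<in> standard_simplex (Suc n - i)" if "x \<in> standard_simplex (n - i)"
    using that assms simplical_face_in_standard_simplex[of "Suc n - i" "k - i" x] by (simp add: Suc_diff_le)
  moreover have shifts: "n - (n - i) = i" "Suc n - (n - i) = Suc i" "Suc n - (Suc n - i) = i"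
    using assms by auto
  moreover have shifts: "n - (n - i) = i" "Suc n - (Suc n - i) = i"
    using assms by auto
  ultimately show "back_face n (n - i) (singular_face (Suc n) k \<sigma>) x =
      singular_face (Suc n - i) (k - i) (back_face (Suc n) (Suc n - i) \<sigma>) x"
    using assms unfolding back_face_def singular_face_def shifts by (simp add: Suc_diff_le)
qed

text \<open>This and \<open>singular_face_0_back_face\<close> supply the two hypotheses of
  \<open>leibniz_sum\<close>: dropping the shared vertex of either part gives the same
  splitting.\<close>

lemma singular_face_last_front_face:
  "singular_face (Suc i) (Suc i) (front_face (Suc i) \<sigma>) = front_face i \<sigma>"
proof (rule ext)
  fix x
  have "simplical_face (Suc i) x \<in> standard_simplex (Suc i)" if "x \<in> standard_simplex i"
    using that simplical_face_in_standard_simplex[of "Suc i" "Suc i" x] by simp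
  moreover have "simplical_face (Suc i) x = x" if "x \<in> standard_simplex i"
    using that by (auto simp: simplical_face_def standard_simplex_def fun_eq_iff)
  ultimately show "singular_face (Suc i) (Suc i) (front_face (Suc i) \<sigma>) x = front_face i \<sigma> x"
    by (auto simp: front_face_def singular_face_def)
qed

lemma singular_face_0_back_face:
  assumes "i \<le> n"
  shows "singular_face (Suc n - i) 0 (back_face (Suc n) (Suc n - i) \<sigma>) = back_face (Suc n) (n - i) \<sigma>"
proof (rule ext)
  fix x
  let ?s = "\<lambda>m x l. if l < m then 0 else x (l - m)"
  have "simplical_face 0 x \<in> standard_simplex (Suc n - i)" if "x \<in> standard_simplex (n - i)"
    using that assms simplical_face_in_standard_simplex[of "Suc n - i" 0 x] by (simp add: Suc_diff_le)
  moreover have "?s i (simplical_face 0 x) = ?s (Suc i) x"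
    by (auto simp: simplical_face_def fun_eq_iff)
  moreover have shifts: "n - (n - i) = i" "Suc n - (n - i) = Suc i" "Suc n - (Suc n - i) = i"
    using assms by auto
  ultimately show "singular_face (Suc n - i) 0 (back_face (Suc n) (Suc n - i) \<sigma>) x = back_face (Suc n) (n - i) \<sigma> x"
    using assms unfolding back_face_def singular_face_def shifts by (simp add: Suc_diff_le)
qed

text \<open>The two terms that involve neither \<open>A i k\<close> with \<open>k \<le> i\<close> nor \<open>D i l\<close> with \<open>l > 0\<close>
  carry opposite signs.\<close>

lemma leibniz_sum:
  fixes A D :: "nat \<Rightarrow> nat \<Rightarrow> 'r::ring"
  assumes A: "\<And>i. i \<le> n \<Longrightarrow> A i (Suc i) = P i" and D: "\<And>i. i \<le> n \<Longrightarrow> D i 0 = Q i"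
  shows "(\<Sum>k\<le>Suc n. signed k (\<Sum>i\<le>n. if k \<le> i then A i k * Q i else P i * D i (k - i))) =
    (\<Sum>i\<le>n. (\<Sum>k\<le>Suc i. signed k (A i k)) * Q i) +
    (\<Sum>i\<le>n. signed i (P i) * (\<Sum>l\<le>Suc n - i. signed l (D i l)))"
proof -
  have "(\<Sum>k\<le>Suc n. signed k (if k \<le> i then A i k * Q i else P i * D i (k - i))) =
      (\<Sum>k\<le>Suc i. signed k (A i k)) * Q i + signed i (P i) * (\<Sum>l\<le>Suc n - i. signed l (D i l))"
    if i: "i \<le> n" for i
  proof -
    let ?t = "\<lambda>k. signed k (if k \<le> i then A i k * Q i else P i * D i (k - i))"
    have "{..Suc n} = {..i} \<union> {Suc i..Suc n}"
      using i by auto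
    then have "sum ?t {..Suc n} = sum ?t {..i} + sum ?t {Suc i..Suc n}"
      by (simp only:, intro sum.union_disjoint) auto
    also have "sum ?t {..i} = (\<Sum>k\<le>i. signed k (A i k)) * Q i"
      by (simp add: sum_distrib_right signed_mult_left)
    \<comment> \<open>Reindexing by \<open>l = k - i\<close> makes the sign depend on
      \<open>l + i\<close>; the missing \<open>l = 0\<close> is added below.\<close>
    also have "sum ?t {Suc i..Suc n} = sum ?t {1 + i..(Suc n - i) + i}"
      using i by simp
    also have "\<dots> = (\<Sum>l = 1..Suc n - i. signed (l + i) (P i * D i l))"
      unfolding sum.shift_bounds_cl_nat_ivl by (rule sum.cong) auto
    finally have 1: "sum ?t {..Suc n} = (\<Sum>k\<le>i. signed k (A i k)) * Q i +
        (\<Sum>l = 1..Suc n - i. signed (l + i) (P i * D i l))" .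
    have "{..Suc n - i} = insert 0 {1..Suc n - i}"
      by auto
    then have "signed i (P i) * (\<Sum>l\<le>Suc n - i. signed l (D i l)) =
        signed i (P i * Q i) + (\<Sum>l = 1..Suc n - i. signed (l + i) (P i * D i l))"
      using i by (simp add: D distrib_left sum_distrib_left signed_mult_left signed_mult_right signed_signed add.commute)
    moreover have "(\<Sum>k\<le>Suc i. signed k (A i k)) * Q i = (\<Sum>k\<le>i. signed k (A i k)) * Q i - signed i (P i * Q i)"
      using i by (simp add: A distrib_right) (simp add: signed_def)
    ultimately show ?thesis
      using 1 by simp
  qed
  then show ?thesis
    unfolding signed_sum by (subst sum.swap) (simp add: sum.distrib)
qed

lemma coboundary_cup:
  "cochain_coboundary X (cochain_cup X c d) =
    cochain_add (cochain_cup X (cochain_coboundary X c) d)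
      (cochain_cup X (cochain_twist c) (cochain_coboundary X d))"
proof (intro ext)
  fix m \<sigma>
  show "cochain_coboundary X (cochain_cup X c d) m \<sigma> =
    cochain_add (cochain_cup X (cochain_coboundary X c) d)
      (cochain_cup X (cochain_twist c) (cochain_coboundary X d)) m \<sigma>"
  proof (cases "singular_simplex m X \<sigma> \<and> m > 0")
    case False
    then show ?thesis
      by (auto simp: cochain_add_def cochain_cup_def cochain_coboundary_def)
  next
    case True
    then obtain n where m: "m = Suc n" and \<sigma>: "singular_simplex (Suc n) X \<sigma>"
      using gr0_conv_Suc by auto
    \<comment> \<open>\<open>P\<close> and \<open>Q\<close> evaluate \<open>c\<close> and
      \<open>d\<close> on front and back parts; \<open>A\<close> and \<open>D\<close> evaluate them
      on the faces of parts that are one dimension larger.\<close>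
    define A where "A i k = c i (singular_face (Suc i) k (front_face (Suc i) \<sigma>))" for i k
    define P where "P i = c i (front_face i \<sigma>)" for i
    define Q where "Q i = d (n - i) (back_face (Suc n) (n - i) \<sigma>)" for i
    define D where "D i l = d (n - i) (singular_face (Suc n - i) l (back_face (Suc n) (Suc n - i) \<sigma>))" for i l
    have "cochain_cup X c d n (singular_face (Suc n) k \<sigma>) =
        (\<Sum>i\<le>n. if k \<le> i then A i k * Q i else P i * D i (k - i))" if k: "k \<le> Suc n" for k
    proof -
      have "singular_simplex n X (singular_face (Suc n) k \<sigma>)"
        using singular_simplex_singular_face[OF \<sigma>, of k] k by simp
      then show ?thesis
        using k
        by (auto simp: cochain_cup_def A_def P_def Q_def D_def front_face_singular_face_le
            front_face_singular_face_gt back_face_singular_face_le back_face_singular_face_gt intro!: sum.cong)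
    qed
    then have "cochain_coboundary X (cochain_cup X c d) m \<sigma> =
        (\<Sum>k\<le>Suc n. signed k (\<Sum>i\<le>n. if k \<le> i then A i k * Q i else P i * D i (k - i)))"
      unfolding m coboundary_signed[OF \<sigma>] by (intro sum.cong) auto
    also have "\<dots> = (\<Sum>i\<le>n. (\<Sum>k\<le>Suc i. signed k (A i k)) * Q i) +
        (\<Sum>i\<le>n. signed i (P i) * (\<Sum>l\<le>Suc n - i. signed l (D i l)))"
      by (rule leibniz_sum)
         (simp_all add: A_def P_def D_def Q_def singular_face_last_front_face singular_face_0_back_face)
    also have "(\<Sum>i\<le>n. (\<Sum>k\<le>Suc i. signed k (A i k)) * Q i) = cochain_cup X (cochain_coboundary X c) d m \<sigma>"
    proof -
      have "cochain_coboundary X c (Suc i) (front_face (Suc i) \<sigma>) = (\<Sum>k\<le>Suc i. signed k (A i k))"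
        if "i \<le> n" for i
        using coboundary_signed[OF singular_simplex_front_face[OF \<sigma>, of "Suc i"]] that
        by (simp add: A_def)
      \<comment> \<open>A coboundary has no component in degree 0, so the term \<open>i = 0\<close>
        drops and the index shifts by one.\<close>
      then show ?thesis
        using \<sigma> by (simp add: cochain_cup_def m sum.atMost_Suc_shift Q_def del: sum.atMost_Suc)
    qed
    also have "(\<Sum>i\<le>n. signed i (P i) * (\<Sum>l\<le>Suc n - i. signed l (D i l))) =
        cochain_cup X (cochain_twist c) (cochain_coboundary X d) m \<sigma>"
    proof -
      have "cochain_coboundary X d (Suc n - i) (back_face (Suc n) (Suc n - i) \<sigma>) =
          (\<Sum>l\<le>Suc n - i. signed l (D i l))" if "i \<le> n" for i
      proof -
        have "singular_simplex (Suc (n - i)) X (back_face (Suc n) (Suc n - i) \<sigma>)"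
          using singular_simplex_back_face[OF \<sigma>, of "Suc n - i"] that by (simp add: Suc_diff_le)
        from coboundary_signed[OF this, of d] show ?thesis
          using that by (simp add: D_def Suc_diff_le)
      qed
      \<comment> \<open>Here the last term \<open>i = n + 1\<close> drops, for the same
        reason.\<close>
      then show ?thesis
        using \<sigma> by (simp add: cochain_cup_def m P_def cochain_twist_def)
    qed
    finally show ?thesis
      by (simp add: cochain_add_def)
  qed
qed

section \<open>Algebra of the cup product and of the degree sign\<close>

lemma cochain_cup_in_cochains:
  assumes "c \<in> cochains X" "d \<in> cochains X"
  shows "cochain_cup X c d \<in> cochains X"
proof (rule cochainsI)
  let ?S = "\<lambda>c. {n. \<exists>\<sigma>. c n \<sigma> \<noteq> 0}"
  show "finite ((\<lambda>(i, j). i + j) ` (?S c \<times> ?S d))"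
    using assms by (simp add: cochains_finite)
  fix n \<sigma>
  show "cochain_cup X c d n \<sigma> = 0" if "\<not> singular_simplex n X \<sigma>"
    using that by (simp add: cochain_cup_def)
  show "cochain_cup X c d n \<sigma> = 0" if n: "n \<notin> (\<lambda>(i, j). i + j) ` (?S c \<times> ?S d)"
  proof -
    have "c i (front_face i \<sigma>) * d (n - i) (back_face n (n - i) \<sigma>) = 0" if "i \<le> n" for i
    proof (rule ccontr)
      assume "c i (front_face i \<sigma>) * d (n - i) (back_face n (n - i) \<sigma>) \<noteq> 0"
      then have "c i (front_face i \<sigma>) \<noteq> 0" "d (n - i) (back_face n (n - i) \<sigma>) \<noteq> 0"
        by auto
      then have "(i, n - i) \<in> ?S c \<times> ?S d"
        by auto
      then have "i + (n - i) \<in> (\<lambda>(i, j). i + j) ` (?S c \<times> ?S d)"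
        by (rule image_eqI[rotated]) simp
      then show False using n that by simp
    qed
    then show ?thesis
      by (simp add: cochain_cup_def)
  qed
qed

lemma cochain_cup_add_left:
  "cochain_cup X (cochain_add a b) d = cochain_add (cochain_cup X a d) (cochain_cup X b d)"
  and cochain_cup_add_right:
  "cochain_cup X d (cochain_add a b) = cochain_add (cochain_cup X d a) (cochain_cup X d b)"
  by (auto simp: cochain_cup_def cochain_add_def fun_eq_iff distrib_left distrib_right sum.distrib)

lemma cochain_twist_in_cochains: "c \<in> cochains X \<Longrightarrow> cochain_twist c \<in> cochains X"
  by (rule cochainsI[where S = "{n. \<exists>\<sigma>. c n \<sigma> \<noteq> 0}"])
     (auto simp: cochain_twist_def cochains_eq_0 cochains_finite signed_def)

text \<open>The coboundary raises degree by one, so the two degree signs differ by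
  \<open>-1\<close>.\<close>

lemma coboundary_twist:
  "cochain_coboundary X (cochain_twist c) = cochain_uminus (cochain_twist (cochain_coboundary X c))"
proof (intro ext)
  fix n \<sigma>
  show "cochain_coboundary X (cochain_twist c) n \<sigma> =
      cochain_uminus (cochain_twist (cochain_coboundary X c)) n \<sigma>"
  proof (cases "singular_simplex n X \<sigma> \<and> n > 0")
    case False
    then show ?thesis
      by (auto simp: cochain_coboundary_def cochain_twist_def cochain_uminus_def)
  next
    case True
    then obtain m where n: "n = Suc m" and \<sigma>: "singular_simplex (Suc m) X \<sigma>"
      using gr0_conv_Suc by auto
    have "signed k (signed m x) = - signed (Suc m) (signed k x)" for k and x :: 'b
      by (simp add: signed_def)
    then show ?thesis
      unfolding n cochain_twist_def cochain_uminus_def coboundary_signed[OF \<sigma>]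
      by (simp add: signed_sum sum_negf del: sum.atMost_Suc)
  qed
qed

lemma cochain_twist_twist [simp]: "cochain_twist (cochain_twist c) = c"
  by (simp add: cochain_twist_def signed_def fun_eq_iff)

lemma cochain_cup_zero [simp]:
  "cochain_cup X cochain_zero d = cochain_zero" "cochain_cup X d cochain_zero = cochain_zero"
  by (auto simp: cochain_cup_def cochain_zero_def fun_eq_iff)

section \<open>Cocycles vanishing on small simplices\<close>

text \<open>For a cochain on \<open>X\<close> this is membership in the relative cochains of the
  pair \<open>(X, V)\<close>.\<close>

definition cochain_vanishes_on ::
    "'a topology \<Rightarrow> 'a set \<Rightarrow> ('a, 'r::{comm_ring, comm_monoid_mult}) cochain \<Rightarrow> bool"
  where "cochain_vanishes_on X V c \<longleftrightarrow>
    (\<forall>n \<sigma>. singular_simplex n (subtopology X V) \<sigma> \<longrightarrow> c n \<sigma> = 0)"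

text \<open>With \<open>h\<close> the chain homotopy from the identity to the barycentric subdivision \<open>sd\<close>, the
  cochain \<open>- \<Sum>\<^sub>i c (h (sd\<^sup>i \<tau>))\<close> has coboundary \<open>c\<close> by telescoping. The sum is finite
  because \<open>h\<close> preserves small chains and \<open>c\<close> vanishes on them.\<close>

lemma cocycle_vanishing_on_small_simplices:
  fixes c :: "('a, 'r::{comm_ring, comm_monoid_mult}) cochain"
  assumes open_cover: "\<And>V. V \<in> \<V> \<Longrightarrow> openin X V" "topspace X \<subseteq> \<Union>\<V>"
    and c: "c \<in> cocycles X" and vanish: "\<And>V. V \<in> \<V> \<Longrightarrow> cochain_vanishes_on X V c"
  shows "c \<in> coboundaries X"
proof -
  obtain h :: "nat \<Rightarrow> 'a chain \<Rightarrow> 'a chain"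
    where h0: "\<And>p. h p 0 = 0" and h_diff: "\<And>p a b. h p (a - b) = h p a - h p b"
    and h_chain: "\<And>p X c. singular_chain p X c \<Longrightarrow> singular_chain (Suc p) X (h p c)"
    and h: "\<And>p X c. singular_chain p X c \<Longrightarrow>
      chain_boundary (Suc p) (h p c) + h (p - Suc 0) (chain_boundary p c) = singular_subdivision p c - c"
    using chain_homotopic_singular_subdivision by metis
  let ?sd = "\<lambda>n i. singular_subdivision n ^^ i"
  have cC: "c \<in> cochains X" and dc: "cochain_coboundary X c = cochain_zero"
    using c by (auto simp: cocycles_def)
  define small where
    "small n x \<longleftrightarrow> Poly_Mapping.keys x \<subseteq> {\<sigma>. \<exists>V\<in>\<V>. singular_simplex n (subtopology X V) \<sigma>}"
    for n and x :: "'a chain"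
  have small_h: "small (Suc n) (h n x)" if "small n x" for n x
    using that[unfolded small_def]
  proof (induction x rule: frag_induction)
    case (one \<sigma>)
    then obtain V where V: "V \<in> \<V>" "singular_simplex n (subtopology X V) \<sigma>"
      by auto
    \<comment> \<open>One and the same \<open>h\<close> serves all topologies, so it can be applied
      inside the subspace \<open>V\<close>.\<close>
    then have "singular_chain (Suc n) (subtopology X V) (h n (frag_of \<sigma>))"
      by (intro h_chain) (simp add: singular_chain_of)
    then show ?case
      using V by (auto simp: small_def singular_chain_def)
  next
    case (diff a b)
    then show ?case
      using keys_diff[of "h n a" "h n b"] by (auto simp: small_def h_diff)
  qed (simp add: h0 small_def)
  have eval_small: "chain_eval (c n) x = 0" if "small n x" for n x
    using that vanish by (intro chain_eval_eq_0) (auto simp: small_def cochain_vanishes_on_def)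
  have sd_chain: "singular_chain n X (?sd n i x)" if "singular_chain n X x" for n i x
    using that by (induction i) (auto intro: singular_chain_singular_subdivision)
  have eventually_small: "\<exists>N. \<forall>m\<ge>N. small n (?sd n m x)" if x: "singular_chain n X x" for n x
  proof -
    obtain N where N: "\<And>m f. N \<le> m \<Longrightarrow> f \<in> Poly_Mapping.keys (?sd n m x) \<Longrightarrow>
        \<exists>V\<in>\<V>. f \<in> standard_simplex n \<rightarrow> V"
    proof (rule sufficient_iterated_singular_subdivision_exists[OF open_cover x])
      fix N
      assume "\<And>m f. N \<le> m \<Longrightarrow> f \<in> Poly_Mapping.keys (?sd n m x) \<Longrightarrow>
        \<exists>V\<in>\<V>. f \<in> standard_simplex n \<rightarrow> V"
      then show thesis by (rule that)
    qed
    have "small n (?sd n m x)" if "N \<le> m" for m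
      unfolding small_def
    proof
      fix f assume f: "f \<in> Poly_Mapping.keys (?sd n m x)"
      then have "singular_simplex n X f"
        using sd_chain[OF x, of m] by (auto simp: singular_chain_def)
      with N[OF that f] show "f \<in> {\<sigma>. \<exists>V\<in>\<V>. singular_simplex n (subtopology X V) \<sigma>}"
        by (auto simp: singular_simplex_subtopology Pi_iff image_subset_iff)
    qed
    then show ?thesis by blast
  qed
  define summand where "summand n x i = chain_eval (c (Suc n)) (h n (?sd n i x))" for n x i
  define N where "N n \<tau> = (SOME N. \<forall>m\<ge>N. small n (?sd n m (frag_of \<tau>)))" for n \<tau>
  have N: "small n (?sd n m (frag_of \<tau>))" if "singular_simplex n X \<tau>" "m \<ge> N n \<tau>" for n \<tau> m
    using someI_ex[OF eventually_small[of n "frag_of \<tau>"]] that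
    unfolding N_def singular_chain_of by blast
  define b where
    "b n \<tau> = (if singular_simplex n X \<tau> then - (\<Sum>i<N n \<tau>. summand n (frag_of \<tau>) i) else 0)" for n \<tau>
  \<comment> \<open>The cutoff \<open>N n \<tau>\<close> varies with the simplex. Beyond it all
    summands vanish, so for a chain any sufficiently large common cutoff gives the same
    value.\<close>
  have eval_b: "\<exists>M0. \<forall>M\<ge>M0. chain_eval (b n) x = - (\<Sum>i<M. summand n x i)" if "singular_chain n X x" for n x
    using that unfolding singular_chain_def
  proof (induction x rule: frag_induction)
    case (one \<tau>)
    have eq: "(\<Sum>i<M. summand n (frag_of \<tau>) i) = (\<Sum>i<N n \<tau>. summand n (frag_of \<tau>) i)" if "M \<ge> N n \<tau>" for M
    proof (rule sum.mono_neutral_right)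
      show "\<forall>i\<in>{..<M} - {..<N n \<tau>}. summand n (frag_of \<tau>) i = 0"
        using one N small_h eval_small by (auto simp: summand_def)
    qed (use that in auto)
    show ?case
    proof (intro exI allI impI)
      fix M assume "N n \<tau> \<le> M"
      then show "chain_eval (b n) (frag_of \<tau>) = - (\<Sum>i<M. summand n (frag_of \<tau>) i)"
        using one by (simp add: b_def eq[of M])
    qed
  next
    case (diff x y)
    obtain M1 where M1: "\<forall>M\<ge>M1. chain_eval (b n) x = - (\<Sum>i<M. summand n x i)"
      using diff(1) by (rule exE)
    obtain M2 where M2: "\<forall>M\<ge>M2. chain_eval (b n) y = - (\<Sum>i<M. summand n y i)"
      using diff(2) by (rule exE)
    have "summand n (x - y) i = summand n x i - summand n y i" for i
      by (simp add: summand_def singular_subdivision_power_diff h_diff chain_eval_diff)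
    then have "chain_eval (b n) (x - y) = - (\<Sum>i<M. summand n (x - y) i)" if "M \<ge> max M1 M2" for M
      using M1[rule_format, of M] M2[rule_format, of M] that
      by (simp only: chain_eval_diff sum_subtractf) simp
    then show ?case by blast
  qed (simp add: summand_def h0)
  have "finite (Suc -` {n. \<exists>\<sigma>. c n \<sigma> \<noteq> 0})"
    using cochains_finite[OF cC] by (rule finite_vimageI) auto
  then have "b \<in> cochains X"
    by (rule cochainsI[rotated]) (auto simp: b_def summand_def intro!: sum.neutral chain_eval_eq_0)
  moreover have "c n \<sigma> = cochain_coboundary X b n \<sigma>" for n \<sigma>
  proof (cases "singular_simplex n X \<sigma>")
    case False
    then show ?thesis
      using cC by (simp add: cochains_eq_0 cochain_coboundary_def)
  next
    case \<sigma>: True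
    show ?thesis
    proof (cases n)
      case 0
      \<comment> \<open>No coboundary reaches degree 0, so \<open>c\<close> itself must vanish
        there. A 0-simplex is a single point, its value at \<open>?v\<close>, and hence lies in one
        member of the cover.\<close>
      let ?v = "\<lambda>j::nat. if j = 0 then 1 else (0::real)"
      have "\<sigma> ?v \<in> topspace X"
        using \<sigma> by (auto simp: singular_simplex_def continuous_map_def Pi_iff)
      then obtain V where "V \<in> \<V>" "\<sigma> ?v \<in> V"
        using open_cover by auto
      then have "singular_simplex 0 (subtopology X V) \<sigma>"
        using \<sigma> 0 by (simp add: singular_simplex_subtopology standard_simplex_0)
      then show ?thesis
        using vanish[OF \<open>V \<in> \<V>\<close>] by (simp add: 0 cochain_vanishes_on_def)
    next
      case (Suc m)
      define x where "x i = ?sd n i (frag_of \<sigma>)" for i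
      have x: "singular_chain n X (x i)" for i
        unfolding x_def by (rule sd_chain) (simp add: \<sigma> singular_chain_of)
      have dx: "?sd m i (chain_boundary n (frag_of \<sigma>)) = chain_boundary n (x i)" for i
      proof (induction i)
        case (Suc i)
        then show ?case
          using chain_boundary_singular_subdivision[OF x[of i]] \<open>n = Suc m\<close> by (simp add: x_def)
      qed (simp add: x_def)
      \<comment> \<open>The homotopy identity rewrites \<open>h\<close> of the boundary of
        \<open>x i\<close>; the remaining boundary term is killed by the cocycle
        \<open>c\<close>.\<close>
      have step: "summand m (chain_boundary n (frag_of \<sigma>)) i = chain_eval (c n) (x (Suc i)) - chain_eval (c n) (x i)" for i
      proof -
        have "chain_eval (c n) (chain_boundary (Suc n) (h n (x i))) = 0"
          using chain_eval_boundary[OF h_chain[OF x], of c] dc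
          by (simp add: cochain_zero_def chain_eval_zero)
        moreover have "h m (chain_boundary n (x i)) = x (Suc i) - x i - chain_boundary (Suc n) (h n (x i))"
          using h[OF x, of i] Suc by (simp add: x_def algebra_simps)
        ultimately show ?thesis
          by (simp add: summand_def dx chain_eval_diff flip: Suc)
      qed
      have "singular_chain m X (chain_boundary n (frag_of \<sigma>))"
        using singular_chain_boundary[OF x[of 0]] Suc by (simp add: x_def)
      from eval_b[OF this] obtain M0 where M0: "\<forall>M\<ge>M0.
          chain_eval (b m) (chain_boundary n (frag_of \<sigma>)) = - (\<Sum>i<M. summand m (chain_boundary n (frag_of \<sigma>)) i)"
        by (rule exE)
      \<comment> \<open>Large enough both for the formula for \<open>b\<close> on the boundary and
        for \<open>x ?M\<close> to be small.\<close>
      let ?M = "max M0 (N n \<sigma>)"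
      have "cochain_coboundary X b n \<sigma> = - (\<Sum>i<?M. chain_eval (c n) (x (Suc i)) - chain_eval (c n) (x i))"
        using M0[rule_format, of ?M] \<sigma> by (simp add: Suc coboundary_eval step[unfolded Suc])
      also have "\<dots> = chain_eval (c n) (x 0) - chain_eval (c n) (x ?M)"
        using sum_lessThan_telescope[of "\<lambda>i. chain_eval (c n) (x i)" ?M] by simp
      also have "chain_eval (c n) (x ?M) = 0"
        using N[OF \<sigma>, of ?M] by (intro eval_small) (simp add: x_def)
      finally show ?thesis
        by (simp add: x_def)
    qed
  qed
  ultimately show ?thesis
    unfolding coboundaries_def by (intro image_eqI[of _ _ b]) auto
qed

section \<open>Equivariant homotopies and orbit spaces\<close>

lemma Z2_orbit_eq_imp:
  assumes "Z2_orbit g x = Z2_orbit g y" shows "x = y \<or> x = g y"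
  using assms by (auto simp: Z2_orbit_def doubleton_eq_iff)

text \<open>\<open>U\<close> is open and saturated, so the orbit map restricts to a quotient map on
  it and stays one after taking the product with \<open>[0,1]\<close>. A homotopy commuting with
  \<open>g\<close> at each stage is constant on fibres after projection and therefore descends
  continuously.\<close>

lemma Z2_orbit_space_homotopy:
  fixes X :: "'x topology"
  assumes g: "\<And>x. x \<in> topspace X \<Longrightarrow> g (g x) = x"
    and U: "openin X U" "g ` U = U"
    and hom: "homotopic_with (Z2_map (subtopology X U) g X g) (subtopology X U) X f id"
  shows "openin (Z2_orbit_space X g) (Z2_orbit g ` U)"
    and "\<exists>f'. homotopic_with (\<lambda>_. True) (subtopology (Z2_orbit_space X g) (Z2_orbit g ` U)) (Z2_orbit_space X g) f' id \<and>
      (\<forall>x\<in>U. f' (Z2_orbit g x) = Z2_orbit g (f x))"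
proof -
  let ?\<rho> = "Z2_orbit g"
  let ?Z = "Z2_orbit_space X g"
  let ?V = "subtopology ?Z (?\<rho> ` U)"
  have UX: "U \<subseteq> topspace X"
    using U openin_subset by blast
  have gU: "g x \<in> U" if "x \<in> U" for x
    using U that by blast
  have quo: "quotient_map X ?Z ?\<rho>"
    unfolding Z2_orbit_space_def by (rule quotient_map_quotient_topology)
  have sat: "{x \<in> topspace X. ?\<rho> x \<in> ?\<rho> ` U} = U"
  proof (intro equalityI subsetI)
    fix x assume "x \<in> {x \<in> topspace X. ?\<rho> x \<in> ?\<rho> ` U}"
    then obtain y where "y \<in> U" "?\<rho> x = ?\<rho> y"
      by auto
    then show "x \<in> U"
      using Z2_orbit_eq_imp[of g x y] gU by auto
  qed (use UX in auto)
  show V: "openin ?Z (?\<rho> ` U)"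
    using U UX by (auto simp: Z2_orbit_space_def openin_quotient_topology sat[unfolded Z2_orbit_space_def])
  have quoU: "quotient_map (subtopology X U) ?V ?\<rho>"
    using quotient_map_restriction[OF quo sat] V by blast
  have quoI: "quotient_map (prod_topology unit_interval (subtopology X U)) (prod_topology unit_interval ?V)
      (\<lambda>(t, x). (t, ?\<rho> x))"
    by (rule quotient_map_prod_right[OF _ _ quoU])
       (auto simp: Hausdorff_space_subtopology compact_space_subtopology intro: compact_imp_locally_compact_space)
  obtain h where h: "continuous_map (prod_topology unit_interval (subtopology X U)) X h"
    and h0: "\<And>x. h (0, x) = f x" and h1: "\<And>x. h (1, x) = x"
    and equiv: "\<And>t. t \<in> {0..1} \<Longrightarrow> Z2_map (subtopology X U) g X g (\<lambda>x. h (t, x))"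
    using hom unfolding homotopic_with_def by auto
  \<comment> \<open>A point of the orbit is chosen; the other choice is its translate by
    \<open>g\<close>, where equivariance of \<open>h\<close> gives the same orbit.\<close>
  define K where "K = (\<lambda>(t, O'). ?\<rho> (h (t, SOME x. x \<in> U \<and> ?\<rho> x = O')))"
  have K: "K (t, ?\<rho> x) = ?\<rho> (h (t, x))" if t: "t \<in> {0..1}" and x: "x \<in> U" for t x
  proof -
    define y where "y = (SOME y. y \<in> U \<and> ?\<rho> y = ?\<rho> x)"
    have "y \<in> U \<and> ?\<rho> y = ?\<rho> x"
      unfolding y_def by (rule someI[of _ x]) (use x in auto)
    then have "y = x \<or> y = g x"
      using Z2_orbit_eq_imp by metis
    moreover have "h (t, x) \<in> topspace X"
      using h t x UX by (auto simp: continuous_map_def Pi_iff)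
    moreover have "h (t, g x) = g (h (t, x))"
      using equiv[OF t] x UX by (auto simp: Z2_map_def)
    ultimately have "?\<rho> (h (t, y)) = ?\<rho> (h (t, x))"
      using g by (auto simp: Z2_orbit_def)
    then show ?thesis
      by (simp add: K_def y_def)
  qed
  have "continuous_map (prod_topology unit_interval (subtopology X U)) ?Z (?\<rho> \<circ> h)"
    using h quo continuous_map_compose quotient_imp_continuous_map by blast
  then have "continuous_map (prod_topology unit_interval (subtopology X U)) ?Z (K \<circ> (\<lambda>(t, x). (t, ?\<rho> x)))"
    by (rule continuous_map_eq) (auto simp: K)
  then have "continuous_map (prod_topology unit_interval ?V) ?Z K"
    using continuous_compose_quotient_map[OF quoI] by blast
  then have "homotopic_with (\<lambda>_. True) ?V ?Z (\<lambda>a. K (0, a)) (\<lambda>a. K (1, a))"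
    unfolding homotopic_with_def by (intro exI[of _ K]) auto
  then have "homotopic_with (\<lambda>_. True) ?V ?Z (\<lambda>a. K (0, a)) id"
    by (rule homotopic_with_eq) (auto simp: K h1)
  then show "\<exists>f'. homotopic_with (\<lambda>_. True) ?V ?Z f' id \<and> (\<forall>x\<in>U. f' (?\<rho> x) = ?\<rho> (f x))"
    by (intro exI[of _ "\<lambda>a. K (0, a)"]) (auto simp: K h0)
qed

text \<open>A path is contracted to its midpoint by shrinking it from both ends at the same speed,
  which commutes with path reversal.\<close>

lemma endpoints_homotopic_midpoint:
  assumes U: "openin (fibre_product E p) U" "prod.swap ` U = U"
    and s: "Z2_map (subtopology (fibre_product E p) U) prod.swap (fibrewise_paths E p) reverse_path s"
  shows "homotopic_with (Z2_map (subtopology (fibre_product E p) U) prod.swap (fibre_product E p) prod.swap)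
    (subtopology (fibre_product E p) U) (fibre_product E p)
    (endpoints \<circ> s) (\<lambda>x. (s x (1/2), s x (1/2)))"
proof -
  let ?Y = "fibre_product E p"
  let ?U = "subtopology ?Y U"
  let ?P = "compact_open_topology unit_interval E"
  have sc: "continuous_map ?U ?P s"
    using s continuous_map_into_fulltopology by (auto simp: Z2_map_def fibrewise_paths_def)
  have sx: "s x \<in> topspace (fibrewise_paths E p)" if "x \<in> topspace ?U" for x
    using s that by (auto simp: Z2_map_def continuous_map_def Pi_iff)
  have rev: "s (prod.swap x) = reverse_path (s x)" if "x \<in> topspace ?U" for x
    using s that by (auto simp: Z2_map_def)
  define h where "h = (\<lambda>(t, x). (s x (t / 2), s x (1 - t / 2)))"
  have ev: "continuous_map (prod_topology unit_interval ?U) E (\<lambda>(t, x). s x (\<phi> t))"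
    if \<phi>: "continuous_map unit_interval unit_interval \<phi>" for \<phi>
  proof -
    have "continuous_map (prod_topology unit_interval ?U) (prod_topology ?P unit_interval) (\<lambda>z. (s (snd z), \<phi> (fst z)))"
      unfolding continuous_map_paired
      by (intro conjI continuous_map_compose[OF continuous_map_snd sc, unfolded o_def]
          continuous_map_compose[OF continuous_map_fst \<phi>, unfolded o_def])
    from continuous_map_compose[OF this continuous_map_path_eval] show ?thesis
      by (simp add: o_def case_prod_unfold)
  qed
  have "continuous_map unit_interval unit_interval (\<lambda>t. t / 2)"
    "continuous_map unit_interval unit_interval (\<lambda>t. 1 - t / 2)"
    by (auto simp: continuous_map_in_subtopology intro!: continuous_intros)
  from this[THEN ev] have "continuous_map (prod_topology unit_interval ?U) (prod_topology E E) h"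
    by (simp add: h_def continuous_map_paired case_prod_unfold)
  \<comment> \<open>This is where the paths being fibrewise matters: the shrinking endpoints stay
    over one point of the base.\<close>
  moreover have "p (s x (t / 2)) = p (s x (1 - t / 2))" if "x \<in> topspace ?U" "t \<in> {0..1}" for x t
    using sx[OF that(1)] that(2) by (auto simp: fibrewise_paths_def)
  ultimately have h: "continuous_map (prod_topology unit_interval ?U) ?Y h"
    unfolding fibre_product_def[of E p] continuous_map_in_subtopology
    by (auto simp: h_def fibre_product_def)
  have "Z2_map ?U prod.swap ?Y prod.swap (\<lambda>x. h (t, x))" if t: "t \<in> {0..1}" for t
  proof -
    have "continuous_map ?U (prod_topology unit_interval ?U) (\<lambda>x. (t, x))"
      using t by (auto simp: continuous_map_paired)
    then have "continuous_map ?U ?Y (\<lambda>x. h (t, x))"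
      using continuous_map_compose[OF _ h] by (simp add: o_def)
    \<comment> \<open>Reversal exchanges the parameters \<open>t / 2\<close> and
      \<open>1 - t / 2\<close>, hence the two components of \<open>h\<close>.\<close>
    moreover have "h (t, prod.swap x) = prod.swap (h (t, x))" if "x \<in> topspace ?U" for x
      using t by (simp add: h_def rev[OF that] reverse_path_def)
    ultimately show ?thesis
      by (simp add: Z2_map_def)
  qed
  then show ?thesis
    unfolding homotopic_with_def using h
    by (intro exI[of _ h]) (auto simp: h_def endpoints_def)
qed

section \<open>Products of classes\<close>

text \<open>Cosets become plain sets of translates, to which later statements about
  \<open>cohomology_ring\<close> are reduced by unfolding.\<close>

lemma a_r_coset_cocycle_ring:
  "I +>\<^bsub>cocycle_ring X\<^esub> c = (\<lambda>h. cochain_add h c) ` I"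
  by (auto simp: a_r_coset_def r_coset_def cocycle_ring_def)

lemma zero_in_coboundaries: "cochain_zero \<in> coboundaries X"
  unfolding coboundaries_def by (rule image_eqI[of _ _ cochain_zero]) simp_all

lemma coboundaries_add:
  "a \<in> coboundaries X \<Longrightarrow> b \<in> coboundaries X \<Longrightarrow> cochain_add a b \<in> coboundaries X"
  unfolding coboundaries_def by (auto simp: cochain_add_in_cochains simp flip: coboundary_add)

lemma coboundaries_uminus: "a \<in> coboundaries X \<Longrightarrow> cochain_uminus a \<in> coboundaries X"
  unfolding coboundaries_def by (auto simp: cochain_uminus_in_cochains simp flip: coboundary_uminus)

lemma cochain_add_assoc: "cochain_add (cochain_add a b) c = cochain_add a (cochain_add b c)"
  and cochain_add_zero_left [simp]: "cochain_add cochain_zero c = c"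
  and cochain_add_zero_right [simp]: "cochain_add c cochain_zero = c"
  by (simp_all add: cochain_add_def cochain_zero_def add.assoc)

lemma cohomology_class_cocycles:
  assumes "u \<in> carrier (cohomology_ring X)"
  shows "u \<noteq> {} \<and> u \<subseteq> cocycles X"
proof -
  obtain c where "c \<in> cocycles X" "u = coboundaries X +>\<^bsub>cocycle_ring X\<^esub> c"
    using assms by (auto simp: cohomology_ring_def FactRing_def A_RCOSETS_def RCOSETS_def
        a_r_coset_def cocycle_ring_def)
  then have c: "c \<in> cocycles X" "u = (\<lambda>h. cochain_add h c) ` coboundaries X"
    by (simp_all add: a_r_coset_cocycle_ring)
  have "cochain_add h c = cochain_add c h" for h
    by (simp add: cochain_add_def add.commute)
  then show ?thesis
    using c cocycles_add_coboundary[of c X] zero_in_coboundaries[of X] by (auto simp: coboundaries_def)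
qed

lemma cochain_one_cocycle: "(cochain_one X :: ('a, 'r::{comm_ring, comm_monoid_mult}) cochain) \<in> cocycles X"
proof -
  have "cochain_coboundary X (cochain_one X :: ('a, 'r) cochain) n \<sigma> = 0" for n \<sigma>
  proof (cases "singular_simplex n X \<sigma>")
    case True
    then show ?thesis
      using singular_simplex_singular_face[of n X \<sigma>]
      by (cases "n = Suc 0") (auto simp: cochain_coboundary_def cochain_one_def Let_def intro!: sum.neutral)
  qed (simp add: cochain_coboundary_def)
  then have "cochain_coboundary X (cochain_one X :: ('a, 'r) cochain) = cochain_zero"
    by (simp add: fun_eq_iff cochain_zero_def)
  moreover have "(cochain_one X :: ('a, 'r) cochain) \<in> cochains X"
    by (rule cochainsI[where S = "{0}"]) (auto simp: cochain_one_def)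
  ultimately show ?thesis
    by (simp add: cocycles_def)
qed

text \<open>Front and back faces of a simplex in \<open>V\<close> stay in \<open>V\<close>, so one
  vanishing factor is enough. Thus a product inherits the vanishing of all its factors, each on its
  own set.\<close>

lemma cochain_vanishes_on_cup:
  assumes "cochain_vanishes_on X V c \<or> cochain_vanishes_on X V d"
  shows "cochain_vanishes_on X V (cochain_cup X c d)"
  unfolding cochain_vanishes_on_def
proof (intro allI impI)
  fix n \<sigma> assume \<sigma>: "singular_simplex n (subtopology X V) \<sigma>"
  have "c i (front_face i \<sigma>) * d (n - i) (back_face n (n - i) \<sigma>) = 0" if "i \<le> n" for i
    using assms that singular_simplex_front_face[OF \<sigma>, of i] singular_simplex_back_face[OF \<sigma>, of "n - i"]
    by (auto simp: cochain_vanishes_on_def)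
  then show "cochain_cup X c d n \<sigma> = 0"
    by (simp add: cochain_cup_def)
qed

lemma cochain_cup_coboundary:
  assumes "cochain_coboundary X w = cochain_zero"
  shows "cochain_cup X (cochain_coboundary X b) w = cochain_coboundary X (cochain_cup X b w)"
  by (simp add: coboundary_cup assms)

text \<open>The Leibniz rule is applied to the twist of \<open>a\<close>: the twist is an
  involution, so the sign disappears, and it keeps cocycles closed.\<close>

lemma cochain_cup_coboundary_right:
  assumes "cochain_coboundary X a = cochain_zero"
  shows "cochain_cup X a (cochain_coboundary X b) =
    cochain_coboundary X (cochain_cup X (cochain_twist a) b)"
proof -
  have "cochain_coboundary X (cochain_twist a) = cochain_zero"
    by (simp add: coboundary_twist assms)
      (simp add: cochain_twist_def cochain_uminus_def cochain_zero_def)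
  then show ?thesis
    using coboundary_cup[of X "cochain_twist a" b] by simp
qed

lemma cochain_cup_in_cocycles:
  assumes "a \<in> cocycles X" "b \<in> cocycles X"
  shows "cochain_cup X a b \<in> cocycles X"
  using assms coboundary_cup[of X a b] by (simp add: cocycles_def cochain_cup_in_cochains)

text \<open>An element of a product of classes is a product of representatives up to a coboundary,
  so the claim can be followed through the fold for arbitrary representatives.\<close>

lemma foldr_cup_representatives:
  fixes u :: "nat \<Rightarrow> ('a, 'r::{comm_ring, comm_monoid_mult}) cochain set"
  assumes "\<And>i. i \<in> set js \<Longrightarrow> u i \<noteq> {} \<and> u i \<subseteq> cocycles X"
    and "\<And>i a. i \<in> set js \<Longrightarrow> a \<in> u i \<Longrightarrow> \<exists>b\<in>cochains X.
      cochain_vanishes_on X (V i) (cochain_add a (cochain_coboundary X b))"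
  defines "S \<equiv> \<lambda>js. foldr (\<lambda>a b. a \<otimes>\<^bsub>cohomology_ring X\<^esub> b) (map u js) \<one>\<^bsub>cohomology_ring X\<^esub>"
  shows "S js \<noteq> {} \<and> (\<forall>z\<in>S js. \<forall>h\<in>coboundaries X. cochain_add h z \<in> S js) \<and>
    (\<forall>z\<in>S js. z \<in> cocycles X \<and> (\<exists>b\<in>cochains X. \<forall>i\<in>set js.
      cochain_vanishes_on X (V i) (cochain_add z (cochain_coboundary X b))))"
  using assms(1,2)
proof (induction js)
  case Nil
  have S: "S [] = (\<lambda>h. cochain_add h (cochain_one X)) ` coboundaries X"
    by (simp add: S_def cohomology_ring_def FactRing_def a_r_coset_cocycle_ring)
      (simp add: cocycle_ring_def)
  have "cochain_add h (cochain_one X) \<in> cocycles X" if "h \<in> coboundaries X" for h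
    using that cocycles_add_coboundary[OF cochain_one_cocycle[of X]]
    by (auto simp: coboundaries_def cochain_add_def add.commute)
  moreover have "cochain_add h' (cochain_add h (cochain_one X)) \<in> S []"
    if "h \<in> coboundaries X" "h' \<in> coboundaries X" for h h'
    unfolding S using coboundaries_add[OF that(2,1)] by (simp flip: cochain_add_assoc)
  moreover have "S [] \<noteq> {}"
    unfolding S using zero_in_coboundaries[of X] by blast
  ultimately show ?case
    unfolding S by (auto intro!: exI[of _ cochain_zero])
next
  case (Cons j js)
  \<comment> \<open>Multiplication in the quotient is a union over all pairs of representatives, so
    an element of the product is some \<open>a \<smile> z\<close> plus a coboundary.\<close>
  have S: "S (j # js) = (\<Union>a\<in>u j. \<Union>z\<in>S js. (\<lambda>h. cochain_add h (cochain_cup X a z)) ` coboundaries X)"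
    by (simp add: S_def cohomology_ring_def FactRing_def rcoset_mult_def a_r_coset_cocycle_ring)
      (simp add: cocycle_ring_def)
  have IH: "S js \<noteq> {}" "\<And>z. z \<in> S js \<Longrightarrow> z \<in> cocycles X"
    "\<And>z. z \<in> S js \<Longrightarrow> \<exists>b\<in>cochains X. \<forall>i\<in>set js.
      cochain_vanishes_on X (V i) (cochain_add z (cochain_coboundary X b))"
    using Cons by auto
  \<comment> \<open>Nonemptiness and closure under adding coboundaries are carried along for the end
    of the theorem, where the product is to equal the zero coset as a set.\<close>
  have "S (j # js) \<noteq> {}"
    unfolding S using IH(1) Cons.prems(1)[of j] zero_in_coboundaries by auto
  moreover have "\<forall>z\<in>S (j # js). \<forall>h\<in>coboundaries X. cochain_add h z \<in> S (j # js)"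
  proof (intro ballI)
    fix y h :: "('a, 'r) cochain"
    assume "y \<in> S (j # js)" and h: "h \<in> coboundaries X"
    then obtain a z e where "a \<in> u j" "z \<in> S js" "e \<in> coboundaries X" "y = cochain_add e (cochain_cup X a z)"
      unfolding S by auto
    moreover from this have "cochain_add h y = cochain_add (cochain_add h e) (cochain_cup X a z)"
      by (simp add: cochain_add_assoc)
    ultimately show "cochain_add h y \<in> S (j # js)"
      unfolding S using coboundaries_add[OF h] by auto
  qed
  moreover have "y \<in> cocycles X \<and> (\<exists>b\<in>cochains X. \<forall>i\<in>set (j # js).
      cochain_vanishes_on X (V i) (cochain_add y (cochain_coboundary X b)))" if "y \<in> S (j # js)" for y
  proof -
    obtain a z e where az: "a \<in> u j" "z \<in> S js" and e: "e \<in> cochains X"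
      and y: "y = cochain_add (cochain_coboundary X e) (cochain_cup X a z)"
      using \<open>y \<in> S (j # js)\<close> unfolding S coboundaries_def by auto
    have a: "a \<in> cocycles X" and z: "z \<in> cocycles X"
      using az IH Cons.prems(1)[of j] by auto
    obtain b1 where b1: "b1 \<in> cochains X"
        "cochain_vanishes_on X (V j) (cochain_add a (cochain_coboundary X b1))"
      using Cons.prems(2)[of j a] az by auto
    obtain b2 where b2: "b2 \<in> cochains X"
        "\<And>i. i \<in> set js \<Longrightarrow> cochain_vanishes_on X (V i) (cochain_add z (cochain_coboundary X b2))"
      using IH(3)[of z] az by auto
    define w where "w = cochain_add z (cochain_coboundary X b2)"
    have w: "w \<in> cocycles X"
      unfolding w_def using z b2 by (intro cocycles_add_coboundary)
    have aC: "a \<in> cochains X" "cochain_coboundary X a = cochain_zero"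
      and wC: "w \<in> cochains X" "cochain_coboundary X w = cochain_zero"
      using a w by (auto simp: cocycles_def)
    \<comment> \<open>Read off by expanding the product of the corrected factors
      \<open>a + \<delta> b1\<close> and \<open>w = z + \<delta> b2\<close>; the term
      \<open>- e\<close> removes the coboundary in \<open>y\<close>.\<close>
    define b where "b = cochain_add (cochain_uminus e)
      (cochain_add (cochain_cup X (cochain_twist a) b2) (cochain_cup X b1 w))"
    have "b \<in> cochains X"
      unfolding b_def using e aC wC b1 b2
      by (intro cochain_add_in_cochains cochain_uminus_in_cochains cochain_cup_in_cochains cochain_twist_in_cochains)
    have "cochain_cup X (cochain_add a (cochain_coboundary X b1)) w =
        cochain_add (cochain_add (cochain_cup X a z) (cochain_coboundary X (cochain_cup X (cochain_twist a) b2)))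
          (cochain_coboundary X (cochain_cup X b1 w))"
      by (simp add: cochain_cup_add_left cochain_cup_coboundary wC)
         (simp add: w_def cochain_cup_add_right cochain_cup_coboundary_right aC)
    also have "\<dots> = cochain_add y (cochain_coboundary X b)"
      by (simp add: y b_def coboundary_add coboundary_uminus) (simp add: cochain_add_def cochain_uminus_def add.assoc)
    finally have eq: "cochain_add y (cochain_coboundary X b) =
        cochain_cup X (cochain_add a (cochain_coboundary X b1)) w" ..
    have "cochain_vanishes_on X (V i) (cochain_add y (cochain_coboundary X b))" if "i \<in> set (j # js)" for i
      unfolding eq using that b1(2) b2(2)[of i] by (intro cochain_vanishes_on_cup) (auto simp: w_def)
    moreover have "y \<in> cocycles X"
      using cocycles_add_coboundary[OF cochain_cup_in_cocycles[OF a z] e]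
      by (simp add: y cochain_add_def add.commute)
    ultimately show ?thesis
      using \<open>b \<in> cochains X\<close> by blast
  qed
  ultimately show ?case by blast
qed

text \<open>\<open>cohomology_map\<close> is a union over representatives, so an equation with the
  zero coset constrains each representative separately.\<close>

lemma cohomology_map_eq_zero_imp_coboundary:
  assumes "cohomology_map X f u = \<zero>\<^bsub>cohomology_ring X\<^esub>" "a \<in> u"
  shows "cochain_pullback X f a \<in> coboundaries X"
proof -
  have "cochain_add cochain_zero (cochain_pullback X f a) \<in> cohomology_map X f u"
    unfolding cohomology_map_def a_r_coset_cocycle_ring using assms(2) zero_in_coboundaries by blast
  then show ?thesis
    unfolding assms(1) by (simp add: cohomology_ring_def FactRing_def)
qed

text \<open>On \<open>V\<close> the cocycle differs by a coboundary from its pullback along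
  \<open>f\<close>, which factors through \<open>D\<close>, where \<open>a\<close> bounds. So
  \<open>a\<close> bounds on \<open>V\<close>, and subtracting an extension of the primitive to
  \<open>X\<close> makes it zero there.\<close>

lemma deformable_imp_vanishes_on:
  fixes a :: "('a, 'r::{comm_ring, comm_monoid_mult}) cochain"
  assumes hom: "homotopic_with (\<lambda>_. True) (subtopology X V) X f id"
    and f: "f ` (topspace X \<inter> V) \<subseteq> D" and a: "a \<in> cocycles X"
    and D: "cochain_pullback (subtopology X D) id a \<in> coboundaries (subtopology X D)"
  shows "\<exists>b\<in>cochains X. cochain_vanishes_on X V (cochain_add a (cochain_coboundary X b))"
proof -
  let ?V = "subtopology X V" and ?D = "subtopology X D"
  obtain b0 where b0: "b0 \<in> cochains ?V"
    "cochain_pullback ?V id a = cochain_add (cochain_pullback ?V f a) (cochain_coboundary ?V b0)"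
    using pullback_homotopic[OF hom a] .
  obtain b1 where b1: "b1 \<in> cochains ?D" "cochain_pullback ?D id a = cochain_coboundary ?D b1"
    using D by (auto simp: coboundaries_def)
  have "continuous_map ?V X f"
    using homotopic_with_imp_continuous_maps[OF hom] by blast
  then have fD: "continuous_map ?V ?D f"
    using f by (auto simp: continuous_map_in_subtopology)
  have "cochain_pullback ?V f a = cochain_pullback ?V f (cochain_pullback ?D id a)"
  proof (intro ext)
    fix n \<sigma>
    show "cochain_pullback ?V f a n \<sigma> = cochain_pullback ?V f (cochain_pullback ?D id a) n \<sigma>"
      using singular_simplex_simplex_map[OF _ fD, of n \<sigma>]
      by (simp add: cochain_pullback_def) (simp add: simplex_map_def)
  qed
  also have "\<dots> = cochain_coboundary ?V (cochain_pullback ?V f b1)"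
    unfolding b1(2) by (rule coboundary_pullback[OF fD])
  finally have *: "cochain_pullback ?V id a =
      cochain_coboundary ?V (cochain_add (cochain_pullback ?V f b1) b0)"
    using b0 by (simp add: coboundary_add)
  define b where "b = cochain_uminus (cochain_add (cochain_pullback ?V f b1) b0)"
  have "b \<in> cochains ?V"
    unfolding b_def using b0(1) b1(1)
    by (intro cochain_uminus_in_cochains cochain_add_in_cochains cochain_pullback_in_cochains)
  \<comment> \<open>Extension by zero is built into the encoding: a cochain on \<open>V\<close>
    already takes the value 0 on all other simplices.\<close>
  then have "b \<in> cochains X"
    by (auto simp: cochains_def singular_simplex_subtopology)
  moreover have "cochain_add a (cochain_coboundary X b) n \<sigma> = 0" if \<sigma>: "singular_simplex n ?V \<sigma>" for n \<sigma>
  proof -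
    have "simplex_map n id \<sigma> = \<sigma>"
      using \<sigma> by (simp add: singular_simplex_def extensional_restrict)
    then have "a n \<sigma> = cochain_pullback ?V id a n \<sigma>"
      using \<sigma> by (simp add: cochain_pullback_def)
    moreover have "cochain_coboundary X b n \<sigma> = - cochain_pullback ?V id a n \<sigma>"
      unfolding b_def coboundary_uminus by (simp add: cochain_uminus_def * coboundary_subtopology[OF \<sigma>])
    ultimately show ?thesis
      by (simp add: cochain_add_def)
  qed
  ultimately show ?thesis
    unfolding cochain_vanishes_on_def by blast
qed


theorem theorem4p9:
  fixes E :: "'e topology" and B :: "'b topology" and p :: "'e \<Rightarrow> 'b"
    and u :: "nat \<Rightarrow> (('e \<times> 'e) set, 'r::{comm_ring, comm_monoid_mult}) cochain set" and k :: nat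
  assumes "hurewicz_fibration E B p"
    and "\<And>i. i \<in> {1..k} \<Longrightarrow> u i \<in> carrier (cohomology_ring (SP2 E p))"
    and "\<And>i. i \<in> {1..k} \<Longrightarrow>
          cohomology_map (dE E p) id (u i) = \<zero>\<^bsub>cohomology_ring (dE E p)\<^esub>"
    and "cup_product (SP2 E p) k u \<noteq> \<zero>\<^bsub>cohomology_ring (SP2 E p)\<^esub>"
  shows "TC_Sigma E p \<ge> enat k"
proof (rule ccontr)
  let ?X = "SP2 E p" and ?Y = "fibre_product E p"
  let ?\<rho> = "Z2_orbit (prod.swap :: 'e \<times> 'e \<Rightarrow> 'e \<times> 'e)"
  assume "\<not> enat k \<le> TC_Sigma E p"
  then obtain n U where n: "n < k"
    and cover: "(\<Union>i\<le>n. U i) = topspace ?Y"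
    and U: "\<And>i. i \<le> n \<Longrightarrow> openin ?Y (U i) \<and> prod.swap ` U i = U i \<and>
        (\<exists>s. Z2_map (subtopology ?Y (U i)) prod.swap (fibrewise_paths E p) reverse_path s \<and>
             homotopic_with (Z2_map (subtopology ?Y (U i)) prod.swap ?Y prod.swap)
               (subtopology ?Y (U i)) ?Y (endpoints \<circ> s) id)"
    unfolding TC_Sigma_def secat_Z2_def not_le Inf_less_iff by auto
  have UY: "U i \<subseteq> topspace ?Y" if "i \<le> n" for i
    using U[OF that] openin_subset by blast
  have deform: "openin ?X (?\<rho> ` U i) \<and>
      (\<exists>f. homotopic_with (\<lambda>_. True) (subtopology ?X (?\<rho> ` U i)) ?X f id \<and>
        f ` (topspace ?X \<inter> ?\<rho> ` U i) \<subseteq> ?\<rho> ` {(e, e) | e. e \<in> topspace E})" if i: "i \<le> n" for i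
  proof -
    let ?U = "subtopology ?Y (U i)"
    obtain s where s: "Z2_map ?U prod.swap (fibrewise_paths E p) reverse_path s"
        "homotopic_with (Z2_map ?U prod.swap ?Y prod.swap) ?U ?Y (endpoints \<circ> s) id"
      and Ui: "openin ?Y (U i)" "prod.swap ` U i = U i"
      using U[OF i] by blast
    let ?m = "\<lambda>x. (s x (1/2), s x (1/2))"
    have hom: "homotopic_with (Z2_map ?U prod.swap ?Y prod.swap) ?U ?Y ?m id"
      using homotopic_with_trans[OF homotopic_with_symD[OF endpoints_homotopic_midpoint[OF Ui s(1)]] s(2)] .
    have swap: "prod.swap (prod.swap x) = x" for x :: "'e \<times> 'e"
      by simp
    obtain f where f: "homotopic_with (\<lambda>_. True) (subtopology ?X (?\<rho> ` U i)) ?X f id"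
        "\<And>x. x \<in> U i \<Longrightarrow> f (?\<rho> x) = ?\<rho> (?m x)"
      using Z2_orbit_space_homotopy(2)[OF swap Ui hom] unfolding SP2_def by blast
    have "s x (1/2) \<in> topspace E" if "x \<in> U i" for x
    proof -
      have "x \<in> topspace ?U"
        using that UY[OF i] by auto
      then have "?m x \<in> topspace ?Y"
        using homotopic_with_imp_continuous_maps[OF hom] by (auto simp: continuous_map_def Pi_iff)
      then show ?thesis
        by (simp add: fibre_product_def)
    qed
    then have "f ` (topspace ?X \<inter> ?\<rho> ` U i) \<subseteq> ?\<rho> ` {(e, e) | e. e \<in> topspace E}"
      using f(2) by auto
    then show ?thesis
      using f(1) Z2_orbit_space_homotopy(1)[OF swap Ui hom] unfolding SP2_def by blast
  qed
  \<comment> \<open>Classes are numbered from 1 and open sets from 0, hence \<open>i - 1\<close>.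
    Since \<open>n < k\<close>, every set is matched with a class; surplus classes get the empty
    set, on which vanishing is trivial.\<close>
  define V where "V i = (if i \<le> Suc n then ?\<rho> ` U (i - 1) else {})" for i
  have V_open: "openin ?X (V i)" for i
    using deform[of "i - 1"] by (auto simp: V_def)
  have V_cover: "topspace ?X \<subseteq> \<Union>(V ` {1..k})"
  proof
    fix x assume "x \<in> topspace ?X"
    then obtain y where y: "y \<in> topspace ?Y" "x = ?\<rho> y"
      by (auto simp: SP2_def Z2_orbit_space_def)
    then obtain i where "i \<le> n" "y \<in> U i"
      using cover by blast
    then have "x \<in> V (Suc i)" "Suc i \<in> {1..k}"
      using y n by (auto simp: V_def)
    then show "x \<in> \<Union>(V ` {1..k})"
      by blast
  qed
  have van: "\<exists>b\<in>cochains ?X. cochain_vanishes_on ?X (V i) (cochain_add a (cochain_coboundary ?X b))"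
    if i: "i \<in> {1..k}" and a: "a \<in> u i" for i a
  proof (cases "i \<le> Suc n")
    case True
    then have "i - 1 \<le> n" and V: "V i = ?\<rho> ` U (i - 1)"
      by (auto simp: V_def)
    obtain f where "homotopic_with (\<lambda>_. True) (subtopology ?X (V i)) ?X f id"
        "f ` (topspace ?X \<inter> V i) \<subseteq> ?\<rho> ` {(e, e) | e. e \<in> topspace E}"
      using deform[OF \<open>i - 1 \<le> n\<close>] unfolding V by (elim conjE exE)
    moreover have "a \<in> cocycles ?X"
      using cohomology_class_cocycles[OF assms(2)[OF i]] a by blast
    moreover have "cochain_pullback (dE E p) id a \<in> coboundaries (dE E p)"
      using cohomology_map_eq_zero_imp_coboundary[OF assms(3)[OF i] a] .
    ultimately show ?thesis
      unfolding dE_def by (rule deformable_imp_vanishes_on)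
  next
    case False
    then show ?thesis
      by (intro bexI[of _ cochain_zero])
         (auto simp: V_def cochain_vanishes_on_def singular_simplex_empty)
  qed
  let ?S = "cup_product ?X k u"
  have set_upt_eq: "set [1..<Suc k] = {1..k}"
    by auto
  have rep: "?S \<noteq> {} \<and> (\<forall>z\<in>?S. \<forall>h\<in>coboundaries ?X. cochain_add h z \<in> ?S) \<and>
    (\<forall>z\<in>?S. z \<in> cocycles ?X \<and> (\<exists>b\<in>cochains ?X. \<forall>i\<in>{1..k}.
      cochain_vanishes_on ?X (V i) (cochain_add z (cochain_coboundary ?X b))))"
    unfolding cup_product_def set_upt_eq[symmetric]
  proof (rule foldr_cup_representatives)
    fix i assume "i \<in> set [1..<Suc k]"
    then have i: "i \<in> {1..k}" by auto
    show "u i \<noteq> {} \<and> u i \<subseteq> cocycles ?X"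
      by (rule cohomology_class_cocycles[OF assms(2)[OF i]])
    show "\<exists>b\<in>cochains ?X. cochain_vanishes_on ?X (V i) (cochain_add a (cochain_coboundary ?X b))"
      if "a \<in> u i" for a
      using van[OF i that] .
  qed
  note S_add = rep[THEN conjunct2, THEN conjunct1, rule_format]
  note S_cocycle = rep[THEN conjunct2, THEN conjunct2, rule_format, THEN conjunct1]
  note S_vanish = rep[THEN conjunct2, THEN conjunct2, rule_format, THEN conjunct2]
  have sub: "?S \<subseteq> coboundaries ?X"
  proof
    fix z assume z: "z \<in> ?S"
    obtain b where b: "b \<in> cochains ?X"
        "\<forall>i\<in>{1..k}. cochain_vanishes_on ?X (V i) (cochain_add z (cochain_coboundary ?X b))"
      using S_vanish[OF z] by (rule bexE)
    let ?w = "cochain_add z (cochain_coboundary ?X b)"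
    have "?w \<in> coboundaries ?X"
    proof (rule cocycle_vanishing_on_small_simplices)
      show "?w \<in> cocycles ?X"
        using cocycles_add_coboundary[OF S_cocycle[OF z] b(1)] .
    qed (use V_open V_cover b(2) in auto)
    moreover have "cochain_uminus (cochain_coboundary ?X b) \<in> coboundaries ?X"
      using b(1) by (intro coboundaries_uminus) (simp add: coboundaries_def)
    ultimately have "cochain_add ?w (cochain_uminus (cochain_coboundary ?X b)) \<in> coboundaries ?X"
      by (rule coboundaries_add)
    then show "z \<in> coboundaries ?X"
      by (simp add: cochain_add_def cochain_uminus_def)
  qed
  obtain z where z: "z \<in> ?S"
    using rep[THEN conjunct1] by blast
  \<comment> \<open>The zero class is the whole set of coboundaries, so \<open>sub\<close> alone is
    not enough. Any \<open>y\<close> is reached from one \<open>z\<close> in the product by adding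
    the coboundary \<open>y - z\<close>.\<close>
  have "y \<in> ?S" if "y \<in> coboundaries ?X" for y
  proof -
    have "cochain_add y (cochain_uminus z) \<in> coboundaries ?X"
      using that z sub by (intro coboundaries_add coboundaries_uminus) auto
    from S_add[OF z this] show ?thesis
      by (simp add: cochain_add_def cochain_uminus_def)
  qed
  then have "?S = coboundaries ?X"
    using sub by blast
  then show False
    using assms(4) by (simp add: cohomology_ring_def FactRing_def)
qed

end
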